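(* Let $\ell\ge 2$ be a constant integer, let $\emptyset\neq \mathcal{S}\subseteq \mathbf{S}_\ell$, and let $q=q(n)\in(0,1)$ be bounded away from $0$ by a constant and such that $(1-q)n/\ln n\to\infty$ as $n\to\infty$. Let $\Pi_n\sim \mathrm{Mallows}(n,q)$. Then $$\mathbb{E}\,\mathrm{Arr}_{\mathcal{S}}(\Pi_n)=(1+o(1))\,\frac{\Lambda(\mathcal{S})}{1-q^\ell}\,\frac{\prod_{i=1}^{\ell-1}(1-q^i)}{\prod_{i=1}^{\ell-1}(1-q^{\ell+i})}\,n .$$ If moreover $1-q=o(1)$, then $$\mathbb{E}\,\mathrm{Arr}_{\mathcal{S}}(\Pi_n)=(1+o(1))\,|\mathcal{S}|\,\frac{[(\ell-1)!]^2}{(2\ell-1)!}\,n(1-q)^{\ell-1}.$$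
   Context: All asymptotics are as $n\to\infty$. $[t]=\{1,\ldots,t\}$ (with $[0]=\emptyset$) and $\mathbf{S}_t$ is the set of permutations of $[t]$. Mallows distribution: $\mathrm{Mallows}(n,q)$ is the law of a random permutation $\Pi_n\in\mathbf{S}_n$ with $\mathbb{P}(\Pi_n=\sigma)=q^{\mathrm{inv}(\sigma)}/\sum_{\pi\in\mathbf{S}_n}q^{\mathrm{inv}(\pi)}$, where $\mathrm{inv}(\sigma)=|\{(i,j):1\le i<j\le n,\ \sigma(i)>\sigma(j)\}|$. $\mathcal{S}$-arrangements: for $\emptyset\ne\mathcal{S}\subseteq\mathbf{S}_\ell$, $n\ge\ell$ and $0\le k_1,k_2\le n-\ell$, there is an $(\mathcal{S},k_1,k_2)$-arrangement in a permutation $\Pi_n\in\mathbf{S}_n$ if there is $\sigma\in\mathcal{S}$ with $\Pi_n(k_2+i)=k_1+\sigma(i)$ for all $i\in[\ell]$. $\mathrm{Arr}_{\mathcal{S}}(\Pi_n)$ is the number of $\mathcal{S}$-arrangements in $\Pi_n$, i.e. the number of pairs $(k_1,k_2)$ such that there is an $(\mathcal{S},k_1,k_2)$-arrangement in $\Pi_n$. The quantity $\Lambda(\mathcal{S})$: let $Z_1,\ldots,Z_\ell$ be independent geometric random variables with parameter $1-q$, i.e. $\mathbb{P}(Z_j=k)=q^{k-1}(1-q)$ for $k=1,2,\ldots$. Then $$\Lambda(\mathcal{S})=\sum_{\sigma\in\mathcal{S}}\prod_{j=1}^{\ell}\mathbb{P}\big(Z_j=\sigma(j)-|\sigma([j-1])\cap[\sigma(j)-1]|\big).$$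 *)

theory Defs
  imports
    "HOL-Probability.Probability"
    "HOL-Combinatorics.Permutations"
    "HOL-Library.Landau_Symbols"
begin

definition perms :: "nat \<Rightarrow> (nat \<Rightarrow> nat) set" where
  "perms t = {\<sigma>. \<sigma> permutes {1..t}}"

definition inversions :: "nat \<Rightarrow> (nat \<Rightarrow> nat) \<Rightarrow> nat" where
  "inversions n \<sigma> = card {(i, j). 1 \<le> i \<and> i < j \<and> j \<le> n \<and> \<sigma> i > \<sigma> j}"

text \<open>The weights form a probability mass function for \<open>q > 0\<close>; see \<open>pmf_mallows\<close> below.\<close>

definition mallows :: "nat \<Rightarrow> real \<Rightarrow> (nat \<Rightarrow> nat) pmf" where
  "mallows n q = embed_pmf (\<lambda>\<sigma>. if \<sigma> \<in> perms n
     then q ^ inversions n \<sigma> / (\<Sum>\<pi>\<in>perms n. q ^ inversions n \<pi>) else 0)"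

definition has_arrangement ::
    "nat \<Rightarrow> (nat \<Rightarrow> nat) set \<Rightarrow> nat \<Rightarrow> nat \<Rightarrow> (nat \<Rightarrow> nat) \<Rightarrow> bool" where
  "has_arrangement l S k1 k2 \<pi> \<longleftrightarrow> (\<exists>\<sigma>\<in>S. \<forall>i\<in>{1..l}. \<pi> (k2 + i) = k1 + \<sigma> i)"

text \<open>The range \<open>0 \<le> k1, k2 \<le> n - l\<close> is written without truncated subtraction, so the count is
  \<open>0\<close> when \<open>n < l\<close>.\<close>

definition Arr :: "nat \<Rightarrow> (nat \<Rightarrow> nat) set \<Rightarrow> nat \<Rightarrow> (nat \<Rightarrow> nat) \<Rightarrow> nat" where
  "Arr l S n \<pi> = card {(k1, k2). k1 + l \<le> n \<and> k2 + l \<le> n \<and> has_arrangement l S k1 k2 \<pi>}"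

text \<open>The geometric distribution on \<open>{1, 2, \<dots>}\<close>; \<^const>\<open>geometric_pmf\<close> counts failures
  and starts at \<open>0\<close>.\<close>

definition geometric1_pmf :: "real \<Rightarrow> nat pmf" where
  "geometric1_pmf p = map_pmf Suc (geometric_pmf p)"

text \<open>The subtraction never truncates: for a permutation \<open>\<sigma>\<close> the intersection has at most
  \<open>\<sigma> j - 1\<close> elements.\<close>

definition Lambda :: "real \<Rightarrow> nat \<Rightarrow> (nat \<Rightarrow> nat) set \<Rightarrow> real" where
  "Lambda q l S = (\<Sum>\<sigma>\<in>S. \<Prod>j=1..l.
     pmf (geometric1_pmf (1 - q)) (\<sigma> j - card (\<sigma> ` {1..j - 1} \<inter> {1..\<sigma> j - 1})))"

lemma finite_perms: "finite (perms n)"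
  unfolding perms_def by (rule finite_permutations) simp

lemma id_in_perms: "id \<in> perms n"
  by (simp add: perms_def permutes_id)

lemma pmf_mallows:
  assumes "q > 0"
  shows "pmf (mallows n q) \<sigma> = (if \<sigma> \<in> perms n
     then q ^ inversions n \<sigma> / (\<Sum>\<pi>\<in>perms n. q ^ inversions n \<pi>) else 0)"
proof -
  define Z where "Z = (\<Sum>\<pi>\<in>perms n. q ^ inversions n \<pi>)"
  define w where "w = (\<lambda>\<sigma>. if \<sigma> \<in> perms n then q ^ inversions n \<sigma> / Z else 0)"
  have Z: "Z > 0"
    unfolding Z_def using assms finite_perms id_in_perms by (intro sum_pos) auto
  have nonneg: "w x \<ge> 0" for x
    using Z assms by (simp add: w_def)
  have "(\<integral>\<^sup>+x. ennreal (w x) \<partial>count_space UNIV) = (\<Sum>x\<in>perms n. ennreal (w x))"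
    by (rule nn_integral_count_space'[OF finite_perms]) (auto simp: w_def)
  also have "\<dots> = ennreal (\<Sum>x\<in>perms n. w x)"
    using nonneg by simp
  also have "(\<Sum>x\<in>perms n. w x) = 1"
    using Z by (simp add: w_def Z_def flip: sum_divide_distrib)
  finally have "pmf (embed_pmf w) \<sigma> = w \<sigma>"
    using nonneg by (intro pmf_embed_pmf) auto
  thus ?thesis
    unfolding mallows_def w_def Z_def .
qed

lemma pmf_geometric1:
  assumes "0 < q" "q < 1" "k \<ge> 1"
  shows "pmf (geometric1_pmf (1 - q)) k = q ^ (k - 1) * (1 - q)"
proof -
  obtain m where "k = Suc m"
    using assms(3) by (cases k) auto
  thus ?thesis
    using assms by (simp add: geometric1_pmf_def pmf_map_inj')
qed

end

theory Submission
  imports Defs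
begin

text \<open>
Reading the entries of a permutation from right to left builds it by successive insertions at the
front, and under the Mallows law these insertions are independent: the permutation of \<open>[n + 1]\<close>
arises from one of \<open>[n]\<close> by prepending a value with exactly \<open>v \<le> n\<close> smaller values, with probability
proportional to \<open>q ^ v\<close>. Follow a block of \<open>l\<close> adjacent positions that carries the values
\<open>k + 1, \<dots>, k + l\<close> in an order belonging to \<open>S\<close>. An insertion with \<open>v \<le> k\<close> moves it to \<open>k + 1\<close>, one with
\<open>v \<ge> k + l\<close> leaves it alone, and the others tear its values apart. In an unending
sequence of insertions with geometric \<open>v\<close> the block survives with probability
\<open>h k = (1 - q ^ (k + 1)) \<cdots> (1 - q ^ (k + l - 1))\<close>. This survival probability is harmonic, and the
truncation of the geometric law at \<open>n\<close> changes the one-step average of \<open>h\<close> by the very factor that the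
normalising constant gains. Hence the expectation of \<open>\<Sum> h k1\<close> over the
arrangements at position \<open>k2\<close> depends only on the number \<open>m = n - l - k2\<close> of entries to the right of the
block (\<open>arr_mean_qpoch\<close>).

With nothing to the left of the block this expectation can be written down, since the block then
contributes \<open>q ^ (l * k + inversions l \<sigma>)\<close> independently of the rest (\<open>arr_mean_0\<close>). It is \<open>Lambda q l S\<close> times a
truncated and rescaled form of the sum \<open>\<Sum>k. q ^ (l * k) * h k\<close>. That sum is a q-beta sum with a product
value (\<open>q_beta_sums\<close>), and \<open>Lambda q l S\<close> times this value is the constant in front of \<open>n\<close>.

Two errors remain. Truncating the q-beta sum costs a multiple of \<open>q ^ m / (1 - q)\<close>
(\<open>truncated_q_beta\<close>). Replacing the weight \<open>h k1\<close> by \<open>1\<close> costs at most a multiple of the expectation of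
\<open>\<Sum> q ^ k1\<close>, and this shrinks by a factor \<open>q\<close> with every insertion (\<open>arr_mean_power\<close>), because
surviving blocks drift upwards. Both errors are geometric in the position, so after summing over all
positions they amount to \<open>O(1 / (1 - q)^2)\<close> plus a term with the factor \<open>q ^ (n - l)\<close>, all relative to
\<open>Lambda q l S\<close> (\<open>expectation_Arr_approx\<close>). The q-beta value is at least a constant divided by \<open>1 - q\<close>
(\<open>qbeta_lower\<close>), so the main term dominates once \<open>(1 - q) n\<close> is large compared with \<open>ln n\<close>. The second
asymptotic formula follows by letting \<open>q\<close> tend to \<open>1\<close> in the constant.
\<close>

section \<open>Prepending a block to a permutation\<close>

text \<open>Opens a gap of \<open>l\<close> unused values just above the value \<open>k\<close>.\<close>

definition make_room :: "nat \<Rightarrow> nat \<Rightarrow> nat \<Rightarrow> nat" where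
  "make_room l k v = (if v \<le> k then v else v + l)"

text \<open>The permutation that starts with the block \<open>k + \<sigma> 1, \<dots>, k + \<sigma> l\<close> and continues with \<open>\<rho>\<close>, whose values
make room for the block. Position \<open>0\<close> lies outside every \<open>{1..n}\<close> and must stay fixed for the result to
permute \<open>{1..m + l}\<close>.\<close>

definition prepend :: "nat \<Rightarrow> nat \<Rightarrow> (nat \<Rightarrow> nat) \<Rightarrow> (nat \<Rightarrow> nat) \<Rightarrow> nat \<Rightarrow> nat" where
  "prepend l k \<sigma> \<rho> i = (if i = 0 then 0 else if i \<le> l then k + \<sigma> i else make_room l k (\<rho> (i - l)))"

lemma permsD:
  assumes "\<sigma> \<in> perms n"
  shows "\<And>i. i \<in> {1..n} \<Longrightarrow> \<sigma> i \<in> {1..n}" "\<And>i. i \<notin> {1..n} \<Longrightarrow> \<sigma> i = i"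
    "inj \<sigma>" "\<sigma> ` {1..n} = {1..n}"
  using assms unfolding perms_def
  by (simp_all only: mem_Collect_eq permutes_in_image permutes_inj permutes_image)
    (simp add: permutes_not_in)

lemma permsI:
  assumes "\<And>i. i \<in> {1..n} \<Longrightarrow> \<sigma> i \<in> {1..n}" "\<And>i. i \<notin> {1..n} \<Longrightarrow> \<sigma> i = i" "inj_on \<sigma> {1..n}"
  shows "\<sigma> \<in> perms n"
proof -
  have "\<sigma> ` {1..n} = {1..n}"
    using assms(1,3) by (intro endo_inj_surj) auto
  hence "bij_betw \<sigma> {1..n} {1..n}"
    using assms(3) by (simp add: bij_betw_def)
  thus ?thesis
    unfolding perms_def using assms(2) by (auto intro!: bij_imp_permutes)
qed

lemma make_room_notin: "make_room l k v \<notin> {k+1..k+l}"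
  by (auto simp: make_room_def)

lemma inj_make_room: "inj (make_room l k)"
  by (auto simp: inj_def make_room_def split: if_splits)

lemma make_room_less_iff: "make_room l k u < make_room l k v \<longleftrightarrow> u < v"
  by (auto simp: make_room_def)

lemma prepend_in_perms:
  assumes \<sigma>: "\<sigma> \<in> perms l" and \<rho>: "\<rho> \<in> perms m" and k: "k \<le> m"
  shows "prepend l k \<sigma> \<rho> \<in> perms (m + l)"
proof (rule permsI)
  fix i assume i: "i \<in> {1..m + l}"
  show "prepend l k \<sigma> \<rho> i \<in> {1..m + l}"
  proof (cases "i \<le> l")
    case True
    thus ?thesis using i k permsD(1)[OF \<sigma>, of i] by (auto simp: prepend_def)
  next
    case False
    hence "i - l \<in> {1..m}" using i by auto
    thus ?thesis using i k False permsD(1)[OF \<rho>, of "i - l"] by (auto simp: prepend_def make_room_def)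
  qed
next
  fix i assume i: "i \<notin> {1..m + l}"
  show "prepend l k \<sigma> \<rho> i = i"
  proof (cases "i = 0")
    case False
    hence "i - l \<notin> {1..m}" "i > m + l" using i by auto
    thus ?thesis using k permsD(2)[OF \<rho>, of "i - l"] by (auto simp: prepend_def make_room_def)
  qed (simp add: prepend_def)
next
  have low: "prepend l k \<sigma> \<rho> i \<in> {k+1..k+l}" if "i \<in> {1..l}" for i
    using permsD(1)[OF \<sigma> that] that by (auto simp: prepend_def)
  have high: "prepend l k \<sigma> \<rho> i \<notin> {k+1..k+l}" if "i > l" for i
    using make_room_notin[of l k "\<rho> (i - l)"] that by (simp add: prepend_def)
  show "inj_on (prepend l k \<sigma> \<rho>) {1..m + l}"
  proof (rule inj_onI)
    fix i j assume ij: "i \<in> {1..m+l}" "j \<in> {1..m+l}"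
      and eq: "prepend l k \<sigma> \<rho> i = prepend l k \<sigma> \<rho> j"
    have le: "i \<le> l \<longleftrightarrow> j \<le> l"
      using low[of i] low[of j] high[of i] high[of j] ij eq
      by (metis atLeastAtMost_iff linorder_not_le)
    show "i = j"
    proof (cases "i \<le> l")
      case True
      hence "\<sigma> i = \<sigma> j" using eq le ij by (simp add: prepend_def)
      thus ?thesis using permsD(3)[OF \<sigma>] by (simp add: inj_eq)
    next
      case False
      hence "make_room l k (\<rho> (i - l)) = make_room l k (\<rho> (j - l))"
        using eq le ij by (simp add: prepend_def)
      hence "i - l = j - l" using permsD(3)[OF \<rho>] inj_make_room by (simp add: inj_eq)
      thus ?thesis using False le by simp
    qed
  qed
qed

text \<open>Deleting the block and closing the gap that it leaves among the values inverts \<open>prepend\<close>: the other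
entries avoid the values of the block because these are already taken.\<close>

lemma bij_betw_prepend:
  assumes \<sigma>: "\<sigma> \<in> perms l" and k: "k \<le> m"
  shows "bij_betw (prepend l k \<sigma>) (perms m) {\<pi> \<in> perms (m + l). \<forall>i\<in>{1..l}. \<pi> i = k + \<sigma> i}"
  unfolding bij_betw_def
proof (intro conjI equalityI subsetI)
  show "inj_on (prepend l k \<sigma>) (perms m)"
  proof (rule inj_onI)
    fix \<rho> \<rho>' assume *: "\<rho> \<in> perms m" "\<rho>' \<in> perms m" "prepend l k \<sigma> \<rho> = prepend l k \<sigma> \<rho>'"
    have "\<rho> i = \<rho>' i" for i
    proof (cases "i = 0")
      case True
      thus ?thesis using permsD(2)[OF *(1), of 0] permsD(2)[OF *(2), of 0] by simp
    next
      case False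
      have "prepend l k \<sigma> \<rho> (i + l) = prepend l k \<sigma> \<rho>' (i + l)" using *(3) by simp
      thus ?thesis using False inj_make_room[of l k] by (simp add: prepend_def inj_eq)
    qed
    thus "\<rho> = \<rho>'" by auto
  qed
next
  fix \<pi> assume "\<pi> \<in> prepend l k \<sigma> ` perms m"
  thus "\<pi> \<in> {\<pi> \<in> perms (m + l). \<forall>i\<in>{1..l}. \<pi> i = k + \<sigma> i}"
    using prepend_in_perms[OF \<sigma> _ k] by (auto simp: prepend_def)
next
  fix \<pi> assume "\<pi> \<in> {\<pi> \<in> perms (m + l). \<forall>i\<in>{1..l}. \<pi> i = k + \<sigma> i}"
  hence \<pi>: "\<pi> \<in> perms (m + l)" and pre: "\<And>i. i \<in> {1..l} \<Longrightarrow> \<pi> i = k + \<sigma> i" by auto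
  \<comment> \<open>By surjectivity of \<open>\<sigma>\<close> the prefix uses up all of \<open>{k+1..k+l}\<close>, so injectivity keeps later entries out.\<close>
  have avoid: "\<pi> j \<notin> {k+1..k+l}" if "j > l" for j
  proof
    assume "\<pi> j \<in> {k+1..k+l}"
    hence "\<pi> j - k \<in> \<sigma> ` {1..l}" using permsD(4)[OF \<sigma>] by auto
    then obtain i where i: "i \<in> {1..l}" "\<pi> j - k = \<sigma> i" by auto
    hence "\<pi> j = \<pi> i" using pre \<open>\<pi> j \<in> {k+1..k+l}\<close> by auto
    hence "j = i" using permsD(3)[OF \<pi>] by (simp add: inj_eq)
    thus False using that i by simp
  qed
  define \<rho> where "\<rho> i = (if i = 0 then 0 else if \<pi> (i + l) \<le> k then \<pi> (i + l) else \<pi> (i + l) - l)" for i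
  have make_room\<rho>: "make_room l k (\<rho> i) = \<pi> (i + l)" if "i > 0" for i
    using that avoid[of "i + l"] by (auto simp: \<rho>_def make_room_def)
  have eq: "prepend l k \<sigma> \<rho> = \<pi>"
  proof
    fix i
    show "prepend l k \<sigma> \<rho> i = \<pi> i"
      using permsD(2)[OF \<pi>, of 0] pre[of i] make_room\<rho>[of "i - l"] by (auto simp: prepend_def)
  qed
  have "\<rho> \<in> perms m"
  proof (rule permsI)
    fix i assume "i \<in> {1..m}"
    thus "\<rho> i \<in> {1..m}"
      using permsD(1)[OF \<pi>, of "i + l"] avoid[of "i + l"] k by (auto simp: \<rho>_def)
  next
    fix i assume "i \<notin> {1..m}"
    thus "\<rho> i = i"
      using permsD(2)[OF \<pi>, of "i + l"] k by (auto simp: \<rho>_def)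
  next
    show "inj_on \<rho> {1..m}"
    proof (rule inj_onI)
      fix i j assume ij: "i \<in> {1..m}" "j \<in> {1..m}" "\<rho> i = \<rho> j"
      hence "\<pi> (i + l) = \<pi> (j + l)" using make_room\<rho>[of i] make_room\<rho>[of j] by auto
      thus "i = j" using permsD(3)[OF \<pi>] by (simp add: inj_eq)
    qed
  qed
  thus "\<pi> \<in> prepend l k \<sigma> ` perms m" using eq by blast
qed

text \<open>The pairs inside the block give the inversions of \<open>\<sigma>\<close>, the pairs behind it those of \<open>\<rho>\<close>, and each of the
\<open>l\<close> block entries forms an inversion with exactly the \<open>k\<close> values below the block, all of which come later.\<close>

lemma inversions_prepend:
  assumes \<sigma>: "\<sigma> \<in> perms l" and \<rho>: "\<rho> \<in> perms m" and k: "k \<le> m"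
  shows "inversions (m + l) (prepend l k \<sigma> \<rho>) = inversions l \<sigma> + l * k + inversions m \<rho>"
proof -
  let ?\<pi> = "prepend l k \<sigma> \<rho>"
  define A where "A = {(i, j). 1 \<le> i \<and> i < j \<and> j \<le> l \<and> \<sigma> i > \<sigma> j}"
  define B where "B = {1..l} \<times> ((\<lambda>j. j + l) ` {j \<in> {1..m}. \<rho> j \<le> k})"
  define C where "C = map_prod (\<lambda>i. i + l) (\<lambda>i. i + l) ` {(i, j). 1 \<le> i \<and> i < j \<and> j \<le> m \<and> \<rho> i > \<rho> j}"
  have fin: "finite {(i, j). 1 \<le> i \<and> i < j \<and> j \<le> (n::nat) \<and> P i j}" for n P
    by (rule finite_subset[of _ "{1..n} \<times> {1..n}"]) auto
  have finA: "finite A" and finC: "finite C" unfolding A_def C_def using fin by auto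
  have finB: "finite B" unfolding B_def by auto
  have cross: "k + \<sigma> i > make_room l k v \<longleftrightarrow> v \<le> k" if "i \<in> {1..l}" for i v
    using permsD(1)[OF \<sigma> that] by (auto simp: make_room_def)
  have cross2: "make_room l k (\<rho> (j - l)) < k + \<sigma> i \<longleftrightarrow> \<rho> (j - l) \<le> k" if "i \<in> {1..l}" for i j
    using cross[OF that] by blast
  have split: "{(i, j). 1 \<le> i \<and> i < j \<and> j \<le> m + l \<and> ?\<pi> i > ?\<pi> j} = A \<union> B \<union> C"
  proof (intro set_eqI, clarify)
    fix i j :: nat
    consider "\<not> (1 \<le> i \<and> i < j \<and> j \<le> m + l)" | "1 \<le> i" "i < j" "j \<le> l" 
      | "1 \<le> i" "i \<le> l" "l < j" "j \<le> m + l" | "l < i" "i < j" "j \<le> m + l" by linarith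
    thus "(i, j) \<in> {(i, j). 1 \<le> i \<and> i < j \<and> j \<le> m + l \<and> ?\<pi> i > ?\<pi> j} \<longleftrightarrow> (i, j) \<in> A \<union> B \<union> C"
    proof cases
      case 1 thus ?thesis by (auto simp: A_def B_def C_def)
    next
      case 2 thus ?thesis by (auto simp: A_def B_def C_def prepend_def)
    next
      case 3
      hence "(i, j) \<in> B \<longleftrightarrow> \<rho> (j - l) \<le> k"
        by (auto simp: B_def image_iff intro!: exI[of _ "j - l"])
      thus ?thesis using 3 cross2[of i j] by (auto simp: A_def C_def prepend_def)
    next
      case 4
      then obtain i' j' where ij': "i = i' + l" "j = j' + l"
        by (metis le_add_diff_inverse2 less_imp_le_nat less_trans)
      have "(i, j) \<in> C \<longleftrightarrow> \<rho> j' < \<rho> i'"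
        using 4 by (force simp: C_def ij')
      moreover have "(i, j) \<notin> A \<union> B"
        using 4 by (auto simp: A_def B_def)
      ultimately show ?thesis using 4 by (simp add: ij' prepend_def make_room_less_iff)
    qed
  qed
  have disj: "A \<inter> B = {}" "(A \<union> B) \<inter> C = {}" by (auto simp: A_def B_def C_def)
  have cardB: "card B = l * k"
  proof -
    have "{1..k} = \<rho> ` {j \<in> {1..m}. \<rho> j \<le> k}"
    proof (intro equalityI subsetI)
      fix v assume "v \<in> {1..k}"
      hence "v \<in> \<rho> ` {1..m}" using permsD(4)[OF \<rho>] k by auto
      thus "v \<in> \<rho> ` {j \<in> {1..m}. \<rho> j \<le> k}" using \<open>v \<in> {1..k}\<close> by auto
    qed (use permsD(1)[OF \<rho>] in force)
    hence "card {1..k} = card {j \<in> {1..m}. \<rho> j \<le> k}"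
      using permsD(3)[OF \<rho>] by (metis card_image inj_on_subset subset_UNIV)
    thus ?thesis by (simp add: B_def card_cartesian_product card_image)
  qed
  have cardC: "card C = inversions m \<rho>"
    unfolding C_def inversions_def by (rule card_image) (auto simp: inj_on_def)
  show ?thesis
    unfolding inversions_def[of "m + l"] split
    using finA finB finC disj cardB cardC
    by (simp add: card_Un_disjoint) (simp add: A_def inversions_def)
qed

section \<open>Mallows sums and insertion at the front\<close>

definition mallows_sum :: "real \<Rightarrow> nat \<Rightarrow> ((nat \<Rightarrow> nat) \<Rightarrow> real) \<Rightarrow> real" where
  "mallows_sum q n F = (\<Sum>\<pi>\<in>perms n. q ^ inversions n \<pi> * F \<pi>)"

abbreviation mallows_norm :: "real \<Rightarrow> nat \<Rightarrow> real" where
  "mallows_norm q n \<equiv> mallows_sum q n (\<lambda>_. 1)"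

text \<open>The values of \<open>k1\<close> are collected for one position \<open>k2\<close> at a time, because inserting at the front shifts all
positions alike but acts on \<open>k1\<close> in a way that depends on the inserted value.\<close>

definition arr_starts :: "nat \<Rightarrow> (nat \<Rightarrow> nat) set \<Rightarrow> nat \<Rightarrow> nat \<Rightarrow> (nat \<Rightarrow> nat) \<Rightarrow> nat set" where
  "arr_starts l S n k2 \<pi> = {k1. k1 + l \<le> n \<and> has_arrangement l S k1 k2 \<pi>}"

definition arr_sum :: "real \<Rightarrow> nat \<Rightarrow> (nat \<Rightarrow> nat) set \<Rightarrow> nat \<Rightarrow> nat \<Rightarrow> (nat \<Rightarrow> real) \<Rightarrow> real" where
  "arr_sum q l S n k2 g = mallows_sum q n (\<lambda>\<pi>. \<Sum>k\<in>arr_starts l S n k2 \<pi>. g k)"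

lemma finite_arr_starts: "finite (arr_starts l S n k2 \<pi>)"
  by (rule finite_subset[of _ "{..n}"]) (auto simp: arr_starts_def)

lemma mallows_sum_pos: "0 < q \<Longrightarrow> 0 < mallows_norm q n"
  unfolding mallows_sum_def using finite_perms id_in_perms by (intro sum_pos) auto

lemma mallows_sum_mono:
  "0 < q \<Longrightarrow> (\<And>\<pi>. \<pi> \<in> perms n \<Longrightarrow> F \<pi> \<le> G \<pi>) \<Longrightarrow> mallows_sum q n F \<le> mallows_sum q n G"
  unfolding mallows_sum_def by (intro sum_mono mult_left_mono) auto

lemma mallows_sum_cong:
  "(\<And>\<pi>. \<pi> \<in> perms n \<Longrightarrow> F \<pi> = G \<pi>) \<Longrightarrow> mallows_sum q n F = mallows_sum q n G"
  unfolding mallows_sum_def by (intro sum.cong) auto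

lemma mallows_sum_sum: "mallows_sum q n (\<lambda>\<pi>. \<Sum>x\<in>A. F x \<pi>) = (\<Sum>x\<in>A. mallows_sum q n (F x))"
  unfolding mallows_sum_def sum_distrib_left by (rule sum.swap)

lemma mallows_sum_cmult: "mallows_sum q n (\<lambda>\<pi>. c * F \<pi>) = c * mallows_sum q n F"
  unfolding mallows_sum_def sum_distrib_left by (intro sum.cong) auto

lemma mallows_sum_prefix:
  assumes \<sigma>: "\<sigma> \<in> perms l" and k: "k \<le> m"
  shows "mallows_sum q (m + l) (\<lambda>\<pi>. of_bool (\<forall>i\<in>{1..l}. \<pi> i = k + \<sigma> i) * F \<pi>) =
    q ^ (inversions l \<sigma> + l * k) * mallows_sum q m (\<lambda>\<rho>. F (prepend l k \<sigma> \<rho>))"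
proof -
  let ?A = "{\<pi> \<in> perms (m + l). \<forall>i\<in>{1..l}. \<pi> i = k + \<sigma> i}"
  have "mallows_sum q (m + l) (\<lambda>\<pi>. of_bool (\<forall>i\<in>{1..l}. \<pi> i = k + \<sigma> i) * F \<pi>) =
      (\<Sum>\<pi>\<in>?A. q ^ inversions (m + l) \<pi> * F \<pi>)"
    unfolding mallows_sum_def by (intro sum.mono_neutral_cong_right finite_perms) auto
  also have "\<dots> = (\<Sum>\<rho>\<in>perms m. q ^ inversions (m + l) (prepend l k \<sigma> \<rho>) * F (prepend l k \<sigma> \<rho>))"
    by (rule sum.reindex_bij_betw[OF bij_betw_prepend[OF assms], symmetric])
  also have "\<dots> = (\<Sum>\<rho>\<in>perms m. q ^ (inversions l \<sigma> + l * k) *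
      (q ^ inversions m \<rho> * F (prepend l k \<sigma> \<rho>)))"
    by (intro sum.cong refl) (simp add: inversions_prepend[OF \<sigma> _ k] power_add mult_ac)
  finally show ?thesis by (simp add: mallows_sum_def sum_distrib_left)
qed

text \<open>The case of a block of length one: the first entry contributes a factor \<open>q ^ v\<close> that does not depend on the
remaining permutation, which is the independence of the successive insertions.\<close>

lemma mallows_sum_Suc:
  "mallows_sum q (Suc n) F = (\<Sum>v\<le>n. q ^ v * mallows_sum q n (\<lambda>\<rho>. F (prepend 1 v id \<rho>)))"
proof -
  have "{(i, j). 1 \<le> i \<and> i < j \<and> j \<le> 1 \<and> id i > id j} = ({} :: (nat \<times> nat) set)" by auto
  hence inv1: "inversions 1 id = 0" unfolding inversions_def by (metis card.empty)
  have "mallows_sum q (Suc n) F =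
      mallows_sum q (Suc n) (\<lambda>\<pi>. \<Sum>v\<le>n. of_bool (\<forall>i\<in>{1..1}. \<pi> i = v + id i) * F \<pi>)"
  proof (rule mallows_sum_cong)
    fix \<pi> assume "\<pi> \<in> perms (Suc n)"
    hence "\<pi> 1 \<in> {1..Suc n}" using permsD(1)[of \<pi> "Suc n" 1] by simp
    hence *: "{..n} \<inter> {v. \<pi> 1 = v + 1} = {\<pi> 1 - 1}" by auto
    show "F \<pi> = (\<Sum>v\<le>n. of_bool (\<forall>i\<in>{1..1}. \<pi> i = v + id i) * F \<pi>)"
      using * by (simp flip: sum_distrib_right)
  qed
  also have "\<dots> = (\<Sum>v\<le>n. mallows_sum q (n + 1) (\<lambda>\<pi>. of_bool (\<forall>i\<in>{1..1}. \<pi> i = v + id i) * F \<pi>))"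
    unfolding mallows_sum_sum by simp
  also have "\<dots> = (\<Sum>v\<le>n. q ^ v * mallows_sum q n (\<lambda>\<rho>. F (prepend 1 v id \<rho>)))"
    using mallows_sum_prefix[OF id_in_perms[of 1], where q = q and F = F and m = n] inv1
    by (intro sum.cong) auto
  finally show ?thesis .
qed

lemma mallows_norm_Suc: "(1 - q) * mallows_norm q (Suc n) = (1 - q ^ Suc n) * mallows_norm q n"
proof -
  have "mallows_norm q (Suc n) = (\<Sum>v\<le>n. q ^ v) * mallows_norm q n"
    by (simp add: mallows_sum_Suc flip: sum_distrib_right)
  thus ?thesis
    using sum_gp_basic[of q n] by (simp flip: mult.assoc)
qed

lemma mallows_norm_add: "(1 - q) ^ l * mallows_norm q (m + l) = (\<Prod>j=1..l. 1 - q ^ (m + j)) * mallows_norm q m"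
proof (induction l)
  case (Suc l)
  have "(1 - q) ^ Suc l * mallows_norm q (m + Suc l) = (1 - q) ^ l * ((1 - q) * mallows_norm q (Suc (m + l)))"
    by simp
  also have "\<dots> = (1 - q ^ Suc (m + l)) * ((1 - q) ^ l * mallows_norm q (m + l))"
    unfolding mallows_norm_Suc by (simp add: mult_ac)
  finally show ?case unfolding Suc.IH by simp
qed simp

text \<open>An inserted value falling strictly inside the block's range of values would leave a hole there, so it
must lie below the block, which is then lifted by one, or above it.\<close>

lemma has_arrangement_prepend_1:
  assumes S: "S \<subseteq> perms l"
  shows "has_arrangement l S k (Suc k2) (prepend 1 v id \<rho>) \<longleftrightarrow>
    v < k \<and> has_arrangement l S (k - 1) k2 \<rho> \<or> k + l \<le> v \<and> has_arrangement l S k k2 \<rho>"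
proof -
  have shift: "prepend 1 v id \<rho> (Suc k2 + i) = make_room 1 v (\<rho> (k2 + i))" if "i \<in> {1..l}" for i
    using that by (simp add: prepend_def)
  have *: "(\<forall>i\<in>{1..l}. make_room 1 v (\<rho> (k2 + i)) = k + \<sigma> i) \<longleftrightarrow>
      v < k \<and> (\<forall>i\<in>{1..l}. \<rho> (k2 + i) = k - 1 + \<sigma> i) \<or>
      k + l \<le> v \<and> (\<forall>i\<in>{1..l}. \<rho> (k2 + i) = k + \<sigma> i)" (is "?L \<longleftrightarrow> ?R") if "\<sigma> \<in> S" for \<sigma>
  proof -
    have \<sigma>: "\<sigma> \<in> perms l" using that S by auto
    have range: "1 \<le> \<sigma> i" "\<sigma> i \<le> l" if "i \<in> {1..l}" for i using permsD(1)[OF \<sigma> that] by auto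
    show ?thesis
    proof
      assume L: ?L
      have "Suc v \<notin> {k+1..k+l}"
      proof
        assume "Suc v \<in> {k+1..k+l}"
        hence "Suc v - k \<in> \<sigma> ` {1..l}" using permsD(4)[OF \<sigma>] by auto
        then obtain i where i: "i \<in> {1..l}" "Suc v - k = \<sigma> i" by auto
        hence "make_room 1 v (\<rho> (k2 + i)) = Suc v" using L \<open>Suc v \<in> _\<close> by auto
        thus False using make_room_notin[of 1 v "\<rho> (k2 + i)"] by simp
      qed
      then consider "v < k" | "k + l \<le> v" by fastforce
      thus ?R
      proof cases
        case 1
        have "\<rho> (k2 + i) = k - 1 + \<sigma> i" if "i \<in> {1..l}" for i
          using L[rule_format, OF that] range[OF that] 1 by (auto simp: make_room_def split: if_splits)
        thus ?thesis using 1 by blast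
      next
        case 2
        have "\<rho> (k2 + i) = k + \<sigma> i" if "i \<in> {1..l}" for i
          using L[rule_format, OF that] range[OF that] 2 by (auto simp: make_room_def split: if_splits)
        thus ?thesis using 2 by blast
      qed
    next
      assume R: ?R
      show ?L
      proof
        fix i assume i: "i \<in> {1..l}"
        show "make_room 1 v (\<rho> (k2 + i)) = k + \<sigma> i"
          using R i range[OF i] by (auto simp: make_room_def)
      qed
    qed
  qed
  show ?thesis
    unfolding has_arrangement_def using shift * by auto
qed

lemma sum_arr_starts_prepend_1:
  fixes g :: "nat \<Rightarrow> real"
  assumes S: "S \<subseteq> perms l" and v: "v \<le> n"
  shows "(\<Sum>k\<in>arr_starts l S (Suc n) (Suc k2) (prepend 1 v id \<rho>). g k) =
    (\<Sum>k\<in>arr_starts l S n k2 \<rho>. of_bool (v \<le> k) * g (Suc k) + of_bool (k + l \<le> v) * g k)"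
proof -
  let ?A = "arr_starts l S n k2 \<rho>"
  have "arr_starts l S (Suc n) (Suc k2) (prepend 1 v id \<rho>) =
      Suc ` (?A \<inter> {k. v \<le> k}) \<union> (?A \<inter> {k. k + l \<le> v})" (is "?L = ?R")
  proof (intro set_eqI)
    fix k
    show "k \<in> ?L \<longleftrightarrow> k \<in> ?R"
      using v by (cases k) (auto simp: arr_starts_def has_arrangement_prepend_1[OF S, unfolded One_nat_def])
  qed
  moreover have "(\<Sum>k\<in>?R. g k) = (\<Sum>k\<in>Suc ` (?A \<inter> {k. v \<le> k}). g k) + (\<Sum>k\<in>?A \<inter> {k. k + l \<le> v}. g k)"
    by (rule sum.union_disjoint) (auto simp: finite_arr_starts)
  moreover have "(\<Sum>k\<in>Suc ` (?A \<inter> {k. v \<le> k}). g k) = (\<Sum>k\<in>?A. of_bool (v \<le> k) * g (Suc k))"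
    by (subst sum.reindex) (auto simp: finite_arr_starts intro!: sum.mono_neutral_cong_left)
  moreover have "(\<Sum>k\<in>?A \<inter> {k. k + l \<le> v}. g k) = (\<Sum>k\<in>?A. of_bool (k + l \<le> v) * g k)"
    by (auto simp: finite_arr_starts intro!: sum.mono_neutral_cong_left)
  ultimately show ?thesis by (simp add: sum.distrib)
qed

text \<open>The one-step rule for a weight \<open>g\<close> on the base value of a block: the two terms sum the probabilities
proportional to \<open>q ^ v\<close> over the insertions with \<open>v \<le> k\<close> and over those with \<open>k + l \<le> v \<le> n\<close>.\<close>

lemma arr_sum_Suc:
  assumes S: "S \<subseteq> perms l"
  shows "(1 - q) * arr_sum q l S (Suc n) (Suc k2) g =
    arr_sum q l S n k2 (\<lambda>k. g (Suc k) * (1 - q ^ Suc k) + g k * (q ^ (k + l) - q ^ Suc n))"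
proof -
  have eq: "(1 - q) * (\<Sum>v\<le>n. q ^ v * (of_bool (v \<le> k) * a + of_bool (k + l \<le> v) * b)) =
      a * (1 - q ^ Suc k) + b * (q ^ (k + l) - q ^ Suc n)" if "k + l \<le> n" for k :: nat and a b
  proof -
    have "(\<Sum>v\<le>n. q ^ v * (of_bool (v \<le> k) * a + of_bool (k + l \<le> v) * b)) =
        a * (\<Sum>v\<le>n. of_bool (v \<le> k) * q ^ v) + b * (\<Sum>v\<le>n. of_bool (k + l \<le> v) * q ^ v)"
      unfolding sum_distrib_left sum.distrib[symmetric] by (intro sum.cong) (simp_all only: algebra_simps)
    also have "(\<Sum>v\<le>n. of_bool (v \<le> k) * q ^ v) = (\<Sum>v\<le>k. q ^ v)"
      using that by (intro sum.mono_neutral_cong_right) auto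
    also have "(\<Sum>v\<le>n. of_bool (k + l \<le> v) * q ^ v) = (\<Sum>v=k+l..n. q ^ v)"
      by (intro sum.mono_neutral_cong_right) auto
    finally have "(1 - q) * (\<Sum>v\<le>n. q ^ v * (of_bool (v \<le> k) * a + of_bool (k + l \<le> v) * b)) =
        a * ((1 - q) * (\<Sum>v\<le>k. q ^ v)) + b * ((1 - q) * (\<Sum>v=k+l..n. q ^ v))"
      by (simp add: algebra_simps)
    also have "(1 - q) * (\<Sum>v\<le>k. q ^ v) = 1 - q ^ Suc k" by (rule sum_gp_basic)
    also have "(1 - q) * (\<Sum>v=k+l..n. q ^ v) = q ^ (k + l) - q ^ Suc n"
      using that by (rule sum_gp_multiplied)
    finally show ?thesis .
  qed
  have pointwise: "(1 - q) * (\<Sum>v\<le>n. q ^ v * (\<Sum>k\<in>arr_starts l S n k2 \<rho>.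
        of_bool (v \<le> k) * g (Suc k) + of_bool (k + l \<le> v) * g k)) =
      (\<Sum>k\<in>arr_starts l S n k2 \<rho>. g (Suc k) * (1 - q ^ Suc k) + g k * (q ^ (k + l) - q ^ Suc n))" for \<rho>
  proof -
    define A where "A = arr_starts l S n k2 \<rho>"
    define f where "f v k = of_bool (v \<le> k) * g (Suc k) + of_bool (k + l \<le> v) * g k" for v k
    have "(\<Sum>v\<le>n. q ^ v * (\<Sum>k\<in>A. f v k)) = (\<Sum>k\<in>A. \<Sum>v\<le>n. q ^ v * f v k)"
      unfolding sum_distrib_left by (rule sum.swap)
    hence "(1 - q) * (\<Sum>v\<le>n. q ^ v * (\<Sum>k\<in>A. f v k)) = (\<Sum>k\<in>A. (1 - q) * (\<Sum>v\<le>n. q ^ v * f v k))"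
      by (simp only: sum_distrib_left)
    also have "\<dots> = (\<Sum>k\<in>A. g (Suc k) * (1 - q ^ Suc k) + g k * (q ^ (k + l) - q ^ Suc n))"
    proof (rule sum.cong[OF refl])
      fix k assume "k \<in> A"
      hence "k + l \<le> n" by (simp add: A_def arr_starts_def)
      thus "(1 - q) * (\<Sum>v\<le>n. q ^ v * f v k) = g (Suc k) * (1 - q ^ Suc k) + g k * (q ^ (k + l) - q ^ Suc n)"
        unfolding f_def by (rule eq)
    qed
    finally show ?thesis
      unfolding A_def f_def .
  qed
  have first: "arr_sum q l S (Suc n) (Suc k2) g =
      mallows_sum q n (\<lambda>\<rho>. \<Sum>v\<le>n. q ^ v * (\<Sum>k\<in>arr_starts l S n k2 \<rho>.
        of_bool (v \<le> k) * g (Suc k) + of_bool (k + l \<le> v) * g k))"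
  proof -
    have "arr_sum q l S (Suc n) (Suc k2) g = (\<Sum>v\<le>n. q ^ v * mallows_sum q n (\<lambda>\<rho>. \<Sum>k\<in>arr_starts l S n k2 \<rho>.
        of_bool (v \<le> k) * g (Suc k) + of_bool (k + l \<le> v) * g k))"
      unfolding arr_sum_def mallows_sum_Suc
    proof (rule sum.cong[OF refl])
      fix v assume "v \<in> {..n}"
      hence "v \<le> n" by simp
      thus "q ^ v * mallows_sum q n (\<lambda>\<rho>. \<Sum>k\<in>arr_starts l S (Suc n) (Suc k2) (prepend 1 v id \<rho>). g k) =
          q ^ v * mallows_sum q n (\<lambda>\<rho>. \<Sum>k\<in>arr_starts l S n k2 \<rho>.
            of_bool (v \<le> k) * g (Suc k) + of_bool (k + l \<le> v) * g k)"
        by (simp only: sum_arr_starts_prepend_1[OF S])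
    qed
    thus ?thesis by (simp only: mallows_sum_sum mallows_sum_cmult)
  qed
  show ?thesis
    unfolding first unfolding mallows_sum_cmult[symmetric] pointwise unfolding arr_sum_def ..
qed

text \<open>A block at the very front is a prefix, so the sum splits into the choice of \<open>\<sigma>\<close>, the choice of \<open>k\<close>
and a free permutation of the remaining \<open>m\<close> entries. At most one \<open>\<sigma>\<close> can describe a
given prefix, so no arrangement is counted twice.\<close>

lemma arr_sum_0:
  assumes S: "S \<subseteq> perms l"
  shows "arr_sum q l S (m + l) 0 g =
    (\<Sum>\<sigma>\<in>S. q ^ inversions l \<sigma>) * (\<Sum>k\<le>m. q ^ (l * k) * g k) * mallows_norm q m"
proof -
  let ?P = "\<lambda>k \<sigma> \<pi>. \<forall>i\<in>{1..l}. \<pi> i = k + (\<sigma> (i :: nat) :: nat)"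
  have fin: "finite S" using S finite_perms finite_subset by blast
  have uniq: "(\<Sum>\<sigma>\<in>S. of_bool (?P k \<sigma> \<pi>)) = (of_bool (has_arrangement l S k 0 \<pi>) :: real)" for k \<pi>
  proof (cases "has_arrangement l S k 0 \<pi>")
    case True
    then obtain \<sigma> where \<sigma>: "\<sigma> \<in> S" "?P k \<sigma> \<pi>" by (auto simp: has_arrangement_def)
    have "\<tau> = \<sigma>" if \<tau>: "\<tau> \<in> S" "?P k \<tau> \<pi>" for \<tau>
    proof
      fix i
      have mem: "\<tau> \<in> perms l" "\<sigma> \<in> perms l" using \<tau> \<sigma> S by auto
      show "\<tau> i = \<sigma> i"
      proof (cases "i \<in> {1..l}")
        case True
        hence "k + \<tau> i = k + \<sigma> i" using \<tau>(2) \<sigma>(2) by metis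
        thus ?thesis by simp
      qed (simp add: permsD(2)[OF mem(1)] permsD(2)[OF mem(2)])
    qed
    hence "S \<inter> {\<tau>. ?P k \<tau> \<pi>} = {\<sigma>}" using \<sigma> by blast
    thus ?thesis using True fin by simp
  next
    case False
    hence "(\<Sum>\<sigma>\<in>S. of_bool (?P k \<sigma> \<pi>)) = (\<Sum>\<sigma>\<in>S. 0 :: real)"
      by (intro sum.cong) (auto simp: has_arrangement_def)
    thus ?thesis using False by simp
  qed
  have "arr_sum q l S (m + l) 0 g =
      mallows_sum q (m + l) (\<lambda>\<pi>. \<Sum>k\<le>m. \<Sum>\<sigma>\<in>S. of_bool (?P k \<sigma> \<pi>) * g k)"
    unfolding arr_sum_def
  proof (rule mallows_sum_cong)
    fix \<pi>
    have "(\<Sum>k\<in>arr_starts l S (m + l) 0 \<pi>. g k) = (\<Sum>k\<le>m. of_bool (has_arrangement l S k 0 \<pi>) * g k)"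
      by (intro sum.mono_neutral_cong_left) (auto simp: arr_starts_def)
    thus "(\<Sum>k\<in>arr_starts l S (m + l) 0 \<pi>. g k) = (\<Sum>k\<le>m. \<Sum>\<sigma>\<in>S. of_bool (?P k \<sigma> \<pi>) * g k)"
      by (simp only: uniq sum_distrib_right[symmetric])
  qed
  also have "\<dots> = (\<Sum>k\<le>m. \<Sum>\<sigma>\<in>S. q ^ (inversions l \<sigma> + l * k) * (g k * mallows_norm q m))"
    unfolding mallows_sum_sum
  proof (intro sum.cong refl)
    fix k \<sigma> assume *: "k \<in> {..m}" "\<sigma> \<in> S"
    show "mallows_sum q (m + l) (\<lambda>\<pi>. of_bool (?P k \<sigma> \<pi>) * g k) =
        q ^ (inversions l \<sigma> + l * k) * (g k * mallows_norm q m)"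
      using mallows_sum_prefix[of \<sigma> l k m q "\<lambda>_. g k"] mallows_sum_cmult[of q m "g k" "\<lambda>_. 1"] * S by auto
  qed
  also have "\<dots> = (\<Sum>k\<le>m. (\<Sum>\<sigma>\<in>S. q ^ inversions l \<sigma>) * (q ^ (l * k) * g k * mallows_norm q m))"
    by (intro sum.cong refl) (simp add: power_add sum_distrib_left sum_distrib_right mult_ac)
  finally show ?thesis
    by (simp add: mult.assoc sum_distrib_left sum_distrib_right)
qed

section \<open>The q-beta sum\<close>

text \<open>The q-Pochhammer symbol \<open>(q^(k+1); q)_r\<close>. For \<open>r = l - 1\<close> it is the probability that a block of
length \<open>l\<close> with \<open>k\<close> smaller values survives infinitely many insertions in front of it.\<close>

definition qpoch :: "real \<Rightarrow> nat \<Rightarrow> nat \<Rightarrow> real" where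
  "qpoch q r k = (\<Prod>i=1..r. 1 - q ^ (k + i))"

text \<open>A q-analogue of the beta integral: \<open>(q; q)_r / (q^a; q)_(r+1)\<close>, the value of the series in
\<open>q_beta_sums\<close>.\<close>

definition qbeta :: "real \<Rightarrow> nat \<Rightarrow> nat \<Rightarrow> real" where
  "qbeta q a r = (\<Prod>i=1..r. 1 - q ^ i) / (\<Prod>i=0..r. 1 - q ^ (a + i))"

lemma prod_one_minus_ge:
  fixes x :: "'a \<Rightarrow> real"
  assumes "finite I" "\<And>i. i \<in> I \<Longrightarrow> 0 \<le> x i \<and> x i \<le> 1"
  shows "1 - (\<Sum>i\<in>I. x i) \<le> (\<Prod>i\<in>I. 1 - x i)"
  using assms
proof (induction I rule: finite_induct)
  case (insert j I)
  have P: "0 \<le> (\<Prod>i\<in>I. 1 - x i)" "(\<Prod>i\<in>I. 1 - x i) \<le> 1"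
    using insert.prems by (auto intro!: prod_nonneg prod_le_1)
  have "x j * (\<Prod>i\<in>I. 1 - x i) \<le> x j * 1"
    using insert.prems P by (intro mult_left_mono) auto
  thus ?case using insert by (auto simp: algebra_simps)
qed simp

context
  fixes q :: real
  assumes q: "0 < q" "q < 1"
begin

lemma pow_less_1: "0 < n \<Longrightarrow> q ^ n < 1"
  using q by (simp add: power_less_one_iff)

text \<open>For fixed \<open>n \<ge> 1\<close>, \<open>1 - q ^ n\<close> is of the exact order of \<open>1 - q\<close>, uniformly in \<open>q\<close>; the upper bound is
Bernoulli's inequality.\<close>

lemma one_minus_power_bounds:
  "1 \<le> n \<Longrightarrow> 1 - q \<le> 1 - q ^ n" "1 - q ^ n \<le> real n * (1 - q)"
proof -
  show "1 - q ^ n \<le> real n * (1 - q)"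
    using Bernoulli_inequality[of "q - 1" n] q by (simp add: algebra_simps)
  show "1 - q \<le> 1 - q ^ n" if "1 \<le> n"
    using power_decreasing[of 1 n q] q that by simp
qed

lemma qpoch_nonneg: "0 \<le> qpoch q r k" and qpoch_le_1: "qpoch q r k \<le> 1"
  unfolding qpoch_def using q by (auto intro!: prod_nonneg prod_le_1 power_le_one)

lemma qpoch_pos: "0 < qpoch q r k"
  unfolding qpoch_def using pow_less_1 by (auto intro!: prod_pos)

lemma qpoch_mono: "k \<le> k' \<Longrightarrow> qpoch q r k \<le> qpoch q r k'"
  unfolding qpoch_def using q by (auto intro!: prod_mono power_decreasing power_le_one)

lemma one_minus_qpoch_le: "1 - qpoch q r k \<le> real r * q ^ Suc k"
proof -
  have "1 - qpoch q r k \<le> (\<Sum>i=1..r. q ^ (k + i))"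
    using prod_one_minus_ge[of "{1..r}" "\<lambda>i. q ^ (k + i)"] q
    by (simp add: qpoch_def power_le_one)
  also have "\<dots> \<le> (\<Sum>i=1..r. q ^ Suc k)"
    using q by (intro sum_mono power_decreasing) auto
  finally show ?thesis by simp
qed

text \<open>Both sides are the q-Pochhammer symbol of length \<open>r + 1\<close> that starts at \<open>1 - q ^ Suc k\<close>, with its
first or its last factor split off. This is what makes the survival probability harmonic.\<close>

lemma qpoch_Suc_shift: "qpoch q r (Suc k) * (1 - q ^ Suc k) = qpoch q r k * (1 - q ^ (Suc k + r))"
proof (induction r)
  case (Suc r)
  have "qpoch q (Suc r) (Suc k) * (1 - q ^ Suc k) =
      (qpoch q r (Suc k) * (1 - q ^ Suc k)) * (1 - q ^ (Suc k + Suc r))"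
    by (simp add: qpoch_def)
  also have "\<dots> = (qpoch q r k * (1 - q ^ (k + Suc r))) * (1 - q ^ (Suc k + Suc r))"
    by (simp only: Suc.IH add_Suc add_Suc_right)
  finally show ?case by (simp add: qpoch_def)
qed (simp add: qpoch_def)

text \<open>Induction on the number of factors, starting from the geometric series: expanding the last
factor \<open>1 - q ^ (k + r + 1)\<close> expresses the sum through the shorter sums with the exponents \<open>a\<close>
and \<open>a + 1\<close>, and the product formula obeys the same recursion.\<close>

lemma q_beta_sums:
  "1 \<le> a \<Longrightarrow> (\<lambda>k. q ^ (a * k) * qpoch q r k) sums qbeta q a r"
proof (induction r arbitrary: a)
  case 0
  have "(\<lambda>k. (q ^ a) ^ k) sums (1 / (1 - q ^ a))"
    using pow_less_1[of a] q 0 by (intro geometric_sums) auto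
  thus ?case by (simp add: qpoch_def qbeta_def power_mult)
next
  case (Suc r)
  have step: "q ^ (a * k) * qpoch q (Suc r) k =
      q ^ (a * k) * qpoch q r k - q ^ Suc r * (q ^ (Suc a * k) * qpoch q r k)" for k
    by (simp add: qpoch_def power_add algebra_simps)
  have "(\<lambda>k. q ^ (a * k) * qpoch q (Suc r) k) sums (qbeta q a r - q ^ Suc r * qbeta q (Suc a) r)"
    unfolding step using Suc.prems by (intro sums_diff sums_mult Suc.IH) auto
  also have "qbeta q a r - q ^ Suc r * qbeta q (Suc a) r = qbeta q a (Suc r)"
  proof -
    define M where "M = (\<Prod>i=1..r. 1 - q ^ (a + i))"
    define N where "N = (\<Prod>i=1..r. 1 - q ^ i)"
    define u where "u = 1 - q ^ a"
    define w where "w = 1 - q ^ (a + Suc r)"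
    have pos: "M > 0" "u > 0" "w > 0"
      unfolding M_def u_def w_def using Suc.prems pow_less_1 by (auto intro!: prod_pos simp del: power_Suc)
    have A: "(\<Prod>i=0..r. 1 - q ^ (a + i)) = u * M"
      by (simp add: prod.atLeast_Suc_atMost[of 0 r] u_def M_def)
    have B: "(\<Prod>i=0..r. 1 - q ^ (Suc a + i)) = M * w"
      using prod.atLeast_Suc_atMost_Suc_shift[of "\<lambda>i. 1 - q ^ (a + i)" 0 r]
      by (simp add: M_def w_def)
    have C: "(\<Prod>i=0..Suc r. 1 - q ^ (a + i)) = u * M * w"
      using A by (simp add: w_def)
    have "w - q ^ Suc r * u = 1 - q ^ Suc r"
      by (simp add: w_def u_def power_add algebra_simps)
    moreover have "N / (u * M) - q ^ Suc r * (N / (M * w)) = N * (w - q ^ Suc r * u) / (u * M * w)"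
      using pos by (simp add: divide_simps) (simp add: algebra_simps)
    ultimately have "N / (u * M) - q ^ Suc r * (N / (M * w)) = (N * (1 - q ^ Suc r)) / (u * M * w)"
      by simp
    thus ?thesis unfolding qbeta_def A B C by (simp add: N_def)
  qed
  finally show ?case .
qed

text \<open>There is one more factor in the denominator than in the numerator and each is of order \<open>1 - q\<close>,
so the value is of order \<open>1 / (1 - q)\<close>, uniformly in \<open>q\<close>.\<close>

lemma qbeta_lower:
  assumes "1 \<le> a"
  shows "(\<Prod>i=0..r. 1 / real (a + i)) / (1 - q) \<le> qbeta q a r"
proof -
  have "(\<Prod>i=0..r. 1 - q ^ (a + i)) \<le> (\<Prod>i=0..r. real (a + i) * (1 - q))"
    using q by (intro prod_mono conjI one_minus_power_bounds) (auto intro: power_le_one)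
  also have "\<dots> = (\<Prod>i=0..r. real (a + i)) * (1 - q) ^ Suc r"
    by (simp add: prod.distrib)
  finally have den: "(\<Prod>i=0..r. 1 - q ^ (a + i)) \<le> (\<Prod>i=0..r. real (a + i)) * (1 - q) ^ Suc r" .
  have "(1 - q) ^ r = (\<Prod>i=1..r. 1 - q)" by simp
  also have "\<dots> \<le> (\<Prod>i=1..r. 1 - q ^ i)"
    using q by (intro prod_mono conjI one_minus_power_bounds) auto
  finally have num: "(1 - q) ^ r \<le> (\<Prod>i=1..r. 1 - q ^ i)" .
  have "(\<Prod>i=0..r. 1 / real (a + i)) / (1 - q) =
      (1 - q) ^ r / ((\<Prod>i=0..r. real (a + i)) * (1 - q) ^ Suc r)"
    using q by (simp add: prod_dividef)
  also have "\<dots> \<le> qbeta q a r"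
    unfolding qbeta_def using num den q assms pow_less_1
    by (intro frac_le) (auto intro!: prod_pos prod_nonneg power_le_one)
  finally show ?thesis .
qed

text \<open>The quotient \<open>D\<close> is what a block with \<open>m\<close> entries to its right contributes. Cutting the series off
after \<open>m\<close> loses a geometric tail, so the point is the division by \<open>qpoch q l m\<close>, which
may be close to \<open>0\<close>. This does no harm since \<open>D\<close> itself is at most \<open>l / (1 - q)\<close>: replacing every
\<open>qpoch q (l - 1) k\<close> by the largest one, at \<open>k = m\<close>, cancels all but one factor of the denominator, and
the last factor is balanced by the finite geometric sum.\<close>

lemma truncated_q_beta:
  fixes l m :: nat
  assumes l: "1 \<le> l"
  defines "D \<equiv> (\<Sum>k\<le>m. q ^ (l * k) * qpoch q (l - 1) k) / qpoch q l m"
  shows "\<bar>D - qbeta q l (l - 1)\<bar> \<le> (real l)\<^sup>2 * q ^ m / (1 - q)"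
proof -
  define Sm where "Sm = (\<Sum>k\<le>m. q ^ (l * k) * qpoch q (l - 1) k)"
  define Q where "Q = qbeta q l (l - 1)"
  have sums: "(\<lambda>k. q ^ (l * k) * qpoch q (l - 1) k) sums Q"
    unfolding Q_def by (rule q_beta_sums[OF l])
  have nonneg: "0 \<le> q ^ (l * k) * qpoch q (l - 1) k" for k
    using q qpoch_nonneg by simp
  have P: "0 < qpoch q l m" by (rule qpoch_pos)
  have SmQ: "Sm \<le> Q"
    using sum_le_suminf[OF sums_summable[OF sums], of "{..m}"] nonneg sums_unique[OF sums]
    by (simp add: Sm_def)
  have QSm: "Q - Sm \<le> q ^ m / (1 - q)"
  proof -
    have tail: "(\<lambda>k. q ^ (l * (k + Suc m)) * qpoch q (l - 1) (k + Suc m)) sums (Q - Sm)"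
      using sums_split_initial_segment[OF sums, of "Suc m"] by (simp add: Sm_def lessThan_Suc_atMost)
    have geom: "(\<lambda>k. q ^ m * q ^ k) sums (q ^ m * (1 / (1 - q)))"
      using q by (intro sums_mult geometric_sums) auto
    have "q ^ (l * (k + Suc m)) * qpoch q (l - 1) (k + Suc m) \<le> q ^ m * q ^ k" for k
    proof -
      have "m + k \<le> l * (k + Suc m)" using l by (cases l) auto
      hence "q ^ (l * (k + Suc m)) \<le> q ^ (m + k)"
        using q by (intro power_decreasing) auto
      hence "q ^ (l * (k + Suc m)) * qpoch q (l - 1) (k + Suc m) \<le> q ^ (m + k) * 1"
        using qpoch_le_1 qpoch_nonneg q by (intro mult_mono) auto
      thus ?thesis by (simp add: power_add)
    qed
    hence "Q - Sm \<le> q ^ m * (1 / (1 - q))" by (rule sums_le[OF _ tail geom])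
    thus ?thesis by simp
  qed
  have D: "D * qpoch q l m = Sm" using P by (simp add: D_def Sm_def)
  have D0: "0 \<le> D" unfolding D_def using P nonneg by (auto intro!: divide_nonneg_pos sum_nonneg)
  have Dup: "D \<le> real l / (1 - q)"
  proof -
    have "Sm \<le> (\<Sum>k\<le>m. (q ^ l) ^ k * qpoch q (l - 1) m)"
      unfolding Sm_def power_mult using q qpoch_nonneg
      by (intro sum_mono mult_left_mono qpoch_mono) auto
    also have "\<dots> = (\<Sum>k\<le>m. (q ^ l) ^ k) * qpoch q (l - 1) m" by (simp add: sum_distrib_right)
    finally have "(1 - q) * Sm \<le> (1 - q) * (\<Sum>k\<le>m. (q ^ l) ^ k) * qpoch q (l - 1) m"
      using q by simp
    also have "(1 - q) * (\<Sum>k\<le>m. (q ^ l) ^ k) \<le> (1 - q ^ l) * (\<Sum>k\<le>m. (q ^ l) ^ k)"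
      using one_minus_power_bounds(1)[OF l] q by (intro mult_right_mono sum_nonneg) auto
    also have "\<dots> = 1 - q ^ (l * Suc m)" unfolding power_mult by (rule sum_gp_basic)
    also have "\<dots> \<le> real l * (1 - q ^ (m + l))"
    proof -
      have "1 - (q ^ Suc m) ^ l \<le> real l * (1 - q ^ Suc m)"
        using Bernoulli_inequality[of "q ^ Suc m - 1" l] q by (simp add: algebra_simps)
      also have "\<dots> \<le> real l * (1 - q ^ (m + l))"
        using q l power_decreasing[of "Suc m" "m + l" q] by (intro mult_left_mono) auto
      finally show ?thesis by (simp only: power_mult[symmetric] mult.commute[of "Suc m" l])
    qed
    finally have "(1 - q) * Sm \<le> real l * (1 - q ^ (m + l)) * qpoch q (l - 1) m"
      using qpoch_nonneg by (simp add: mult_right_mono)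
    also have "\<dots> = real l * qpoch q l m"
      using l by (cases l) (auto simp: qpoch_def)
    finally have "(1 - q) * D * qpoch q l m \<le> real l * qpoch q l m" using D by (simp add: mult.assoc)
    hence "(1 - q) * D \<le> real l" using P by simp
    thus ?thesis using q by (simp add: field_simps)
  qed
  have "D - Sm = D * (1 - qpoch q l m)" using D by (simp add: algebra_simps)
  also have "\<dots> \<le> real l / (1 - q) * (real l * q ^ m)"
  proof -
    have "1 - qpoch q l m \<le> real l * q ^ Suc m" by (rule one_minus_qpoch_le)
    also have "\<dots> \<le> real l * q ^ m" using q by (intro mult_left_mono power_decreasing) auto
    finally show ?thesis using Dup D0 qpoch_le_1[of l m] q by (intro mult_mono) auto
  qed
  finally have up: "D - Sm \<le> (real l)\<^sup>2 * q ^ m / (1 - q)" by (simp add: power2_eq_square)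
  have "Sm \<le> D"
  proof -
    have "D * qpoch q l m \<le> D * 1" using D0 qpoch_le_1 by (intro mult_left_mono)
    thus ?thesis using D by simp
  qed
  moreover have "1 * (q ^ m / (1 - q)) \<le> (real l)\<^sup>2 * (q ^ m / (1 - q))"
    using q l by (intro mult_right_mono) auto
  ultimately show ?thesis
    using up SmQ QSm unfolding Q_def[symmetric] by auto
qed

end

section \<open>Expected arrangements at a fixed position\<close>

text \<open>Counting inversions by their left end gives the Lehmer code of \<open>\<sigma>\<close>, the form in which the
geometric probabilities in \<open>Lambda\<close> record it.\<close>

lemma inversions_eq_sum:
  "inversions l \<sigma> = (\<Sum>j=1..l. card {i \<in> {j<..l}. \<sigma> i < \<sigma> j})"
proof -
  have "{(i, j). 1 \<le> i \<and> i < j \<and> j \<le> l \<and> \<sigma> i > \<sigma> j} =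
      (SIGMA j:{1..l}. {i \<in> {j<..l}. \<sigma> i < \<sigma> j})"
    by auto
  thus ?thesis by (simp add: inversions_def)
qed

text \<open>Of the \<open>\<sigma> j - 1\<close> values below \<open>\<sigma> j\<close>, those not used before position \<open>j\<close> appear after it. The
argument of the \<open>j\<close>-th geometric probability is therefore one more than the \<open>j\<close>-th entry of the
Lehmer code, and the product of the probabilities is a power of \<open>q\<close> with the number of inversions as exponent.\<close>

lemma Lambda_eq:
  assumes q: "0 < q" "q < 1" and S: "S \<subseteq> perms l"
  shows "Lambda q l S = (1 - q) ^ l * (\<Sum>\<sigma>\<in>S. q ^ inversions l \<sigma>)"
proof -
  have "(\<Prod>j=1..l. pmf (geometric1_pmf (1 - q)) (\<sigma> j - card (\<sigma> ` {1..j - 1} \<inter> {1..\<sigma> j - 1}))) =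
      (1 - q) ^ l * q ^ inversions l \<sigma>" if "\<sigma> \<in> S" for \<sigma>
  proof -
    have \<sigma>: "\<sigma> \<in> perms l" using that S by auto
    have "pmf (geometric1_pmf (1 - q)) (\<sigma> j - card (\<sigma> ` {1..j - 1} \<inter> {1..\<sigma> j - 1})) =
        q ^ card {i \<in> {j<..l}. \<sigma> i < \<sigma> j} * (1 - q)" if j: "j \<in> {1..l}" for j
    proof -
      let ?A = "\<sigma> ` {1..j - 1} \<inter> {1..\<sigma> j - 1}" and ?B = "\<sigma> ` {i \<in> {j<..l}. \<sigma> i < \<sigma> j}"
      have "{1..\<sigma> j - 1} = ?A \<union> ?B"
      proof (intro equalityI subsetI)
        fix v assume v: "v \<in> {1..\<sigma> j - 1}"
        hence "v \<in> \<sigma> ` {1..l}" using permsD(1)[OF \<sigma> j] permsD(4)[OF \<sigma>] by auto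
        then obtain i where i: "i \<in> {1..l}" "v = \<sigma> i" by auto
        consider "i < j" | "i = j" | "j < i" by linarith
        thus "v \<in> ?A \<union> ?B" using i v by cases auto
      next
        fix v assume "v \<in> ?A \<union> ?B"
        thus "v \<in> {1..\<sigma> j - 1}" using permsD(1)[OF \<sigma>] by fastforce
      qed
      moreover have "?A \<inter> ?B = {}"
        using permsD(3)[OF \<sigma>] by (auto simp: inj_eq)
      ultimately have "card {1..\<sigma> j - 1} = card ?A + card ?B"
        by (metis card_Un_disjoint finite_Un finite_atLeastAtMost)
      also have "card ?B = card {i \<in> {j<..l}. \<sigma> i < \<sigma> j}"
        by (intro card_image inj_on_subset[OF permsD(3)[OF \<sigma>]]) auto
      finally have "\<sigma> j - card ?A = Suc (card {i \<in> {j<..l}. \<sigma> i < \<sigma> j})"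
        using permsD(1)[OF \<sigma> j] by auto
      thus ?thesis using pmf_geometric1[OF q, of "Suc (card {i \<in> {j<..l}. \<sigma> i < \<sigma> j})"] by simp
    qed
    hence "(\<Prod>j=1..l. pmf (geometric1_pmf (1 - q)) (\<sigma> j - card (\<sigma> ` {1..j - 1} \<inter> {1..\<sigma> j - 1}))) =
        (\<Prod>j=1..l. q ^ card {i \<in> {j<..l}. \<sigma> i < \<sigma> j} * (1 - q))"
      by (rule prod.cong[OF refl])
    also have "\<dots> = (1 - q) ^ l * q ^ inversions l \<sigma>"
      by (simp add: prod.distrib inversions_eq_sum power_sum)
    finally show ?thesis .
  qed
  thus ?thesis by (simp add: Lambda_def sum_distrib_left)
qed

text \<open>The expectation under \<open>mallows n q\<close> of the sum of \<open>g k1\<close> over the arrangements with second index \<open>k2\<close>.\<close>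

definition arr_mean :: "real \<Rightarrow> nat \<Rightarrow> (nat \<Rightarrow> nat) set \<Rightarrow> nat \<Rightarrow> nat \<Rightarrow> (nat \<Rightarrow> real) \<Rightarrow> real" where
  "arr_mean q l S n k2 g = arr_sum q l S n k2 g / mallows_norm q n"

lemma expectation_Arr:
  assumes q: "0 < q" and n: "l \<le> n"
  shows "measure_pmf.expectation (mallows n q) (\<lambda>\<pi>. real (Arr l S n \<pi>)) =
    (\<Sum>k2\<le>n - l. arr_mean q l S n k2 (\<lambda>_. 1))"
proof -
  have Arr: "real (Arr l S n \<pi>) = (\<Sum>k2\<le>n - l. \<Sum>k1\<in>arr_starts l S n k2 \<pi>. 1)" for \<pi>
  proof -
    have "{(k1, k2). k1 + l \<le> n \<and> k2 + l \<le> n \<and> has_arrangement l S k1 k2 \<pi>} =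
        prod.swap ` (SIGMA k2:{..n - l}. arr_starts l S n k2 \<pi>)"
      using n by (auto simp: arr_starts_def image_iff)
    hence "Arr l S n \<pi> = card (SIGMA k2:{..n - l}. arr_starts l S n k2 \<pi>)"
      unfolding Arr_def by (simp add: card_image)
    thus ?thesis by (simp add: finite_arr_starts)
  qed
  have "measure_pmf.expectation (mallows n q) (\<lambda>\<pi>. real (Arr l S n \<pi>)) =
      (\<Sum>\<pi>\<in>perms n. real (Arr l S n \<pi>) * pmf (mallows n q) \<pi>)"
    by (rule integral_measure_pmf_real[OF finite_perms])
      (auto simp: set_pmf_iff pmf_mallows[OF q] split: if_splits)
  also have "\<dots> = mallows_sum q n (\<lambda>\<pi>. real (Arr l S n \<pi>)) / mallows_norm q n"
    by (simp add: pmf_mallows[OF q] mallows_sum_def sum_divide_distrib mult.commute)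
  also have "\<dots> = (\<Sum>k2\<le>n - l. arr_mean q l S n k2 (\<lambda>_. 1))"
    unfolding Arr mallows_sum_sum[of q n _ "{..n - l}"] by (simp add: arr_mean_def arr_sum_def sum_divide_distrib)
  finally show ?thesis .
qed

context
  fixes q :: real and l :: nat and S :: "(nat \<Rightarrow> nat) set"
  assumes q: "0 < q" "q < 1" and l: "2 \<le> l" and S: "S \<subseteq> perms l"
begin

lemma arr_mean_mono:
  "(\<And>k. k + l \<le> n \<Longrightarrow> f k \<le> g k) \<Longrightarrow> arr_mean q l S n k2 f \<le> arr_mean q l S n k2 g"
  unfolding arr_mean_def arr_sum_def using q mallows_sum_pos[of q n]
  by (intro divide_right_mono mallows_sum_mono sum_mono) (auto simp: arr_starts_def)

lemma arr_mean_cmult: "arr_mean q l S n k2 (\<lambda>k. c * g k) = c * arr_mean q l S n k2 g"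
  by (simp add: arr_mean_def arr_sum_def mallows_sum_cmult flip: sum_distrib_left)

lemma arr_mean_diff:
  "arr_mean q l S n k2 (\<lambda>k. f k - g k) = arr_mean q l S n k2 f - arr_mean q l S n k2 g"
  by (simp add: arr_mean_def arr_sum_def mallows_sum_def sum_subtractf right_diff_distrib diff_divide_distrib)

lemma Lambda_nonneg: "0 \<le> Lambda q l S"
  unfolding Lambda_eq[OF q S] using q by (auto intro!: mult_nonneg_nonneg sum_nonneg)

lemma arr_mean_Suc:
  "arr_mean q l S (Suc n) (Suc k2) g =
    arr_mean q l S n k2 (\<lambda>k. g (Suc k) * (1 - q ^ Suc k) + g k * (q ^ (k + l) - q ^ Suc n)) / (1 - q ^ Suc n)"
proof -
  have pos: "1 - q ^ Suc n > 0" "mallows_norm q n > 0" "mallows_norm q (Suc n) > 0" "1 - q > 0"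
    using q pow_less_1[OF q, of "Suc n"] mallows_sum_pos by (auto simp del: power_Suc)
  have "arr_mean q l S (Suc n) (Suc k2) g =
      ((1 - q) * arr_sum q l S (Suc n) (Suc k2) g) / ((1 - q) * mallows_norm q (Suc n))"
    using pos by (simp add: arr_mean_def)
  thus ?thesis
    unfolding arr_sum_Suc[OF S] mallows_norm_Suc by (simp add: arr_mean_def mult.commute)
qed

text \<open>The survival weight is harmonic: with \<open>h = qpoch q (l - 1)\<close>, the one-step rule gives
\<open>h k * (1 - q ^ (k + l)) + h k * (q ^ (k + l) - q ^ Suc n)\<close>, and the factor \<open>1 - q ^ Suc n\<close> that is
left is, up to the constant \<open>1 - q\<close>, the one by which the normalising constant grows.\<close>

lemma arr_mean_qpoch_Suc:
  "arr_mean q l S (Suc n) (Suc k2) (qpoch q (l - 1)) = arr_mean q l S n k2 (qpoch q (l - 1))"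
proof -
  have eq: "qpoch q (l - 1) (Suc k) * (1 - q ^ Suc k) + qpoch q (l - 1) k * (q ^ (k + l) - q ^ Suc n) =
      (1 - q ^ Suc n) * qpoch q (l - 1) k" for k
  proof -
    have "Suc k + (l - 1) = k + l" using l by simp
    thus ?thesis unfolding qpoch_Suc_shift[OF q] by (simp add: algebra_simps)
  qed
  have "1 - q ^ Suc n \<noteq> 0" using pow_less_1[OF q, of "Suc n"] by simp
  thus ?thesis
    unfolding arr_mean_Suc eq arr_mean_cmult by (simp del: power_Suc)
qed

lemma arr_mean_qpoch:
  "arr_mean q l S (n + k2) k2 (qpoch q (l - 1)) = arr_mean q l S n 0 (qpoch q (l - 1))"
proof (induction k2)
  case (Suc k2)
  thus ?case using arr_mean_qpoch_Suc[of "n + k2" k2] by simp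
qed simp

text \<open>Up to the common normalisation, an insertion lifts the block with probability \<open>1 - q ^ (k + 1)\<close>, which
multiplies the weight \<open>q ^ k\<close> by \<open>q\<close>, and goes above it with probability at most \<open>q ^ (k + l)\<close>. The
resulting factor \<open>q - q ^ (k + 2) + q ^ (k + l)\<close> is at most \<open>q\<close> because \<open>l \<ge> 2\<close>.\<close>

lemma arr_mean_power_Suc:
  "arr_mean q l S (Suc n) (Suc k2) (\<lambda>k. q ^ k) \<le> q * arr_mean q l S n k2 (\<lambda>k. q ^ k)"
proof -
  have pos: "1 - q ^ Suc n > 0" using pow_less_1[OF q, of "Suc n"] by simp
  have le: "q ^ Suc k * (1 - q ^ Suc k) + q ^ k * (q ^ (k + l) - q ^ Suc n) \<le>
      (q * (1 - q ^ Suc n)) * q ^ k" for k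
  proof -
    have "q ^ (k + l) \<le> q ^ (k + 2)" "q ^ Suc (Suc n) \<le> q ^ Suc n"
      using q l by (auto intro!: power_decreasing simp del: power_Suc)
    hence "q - q ^ (k + 2) + q ^ (k + l) - q ^ Suc n \<le> q - q ^ Suc (Suc n)"
      by linarith
    hence "q ^ k * (q - q ^ (k + 2) + q ^ (k + l) - q ^ Suc n) \<le> q ^ k * (q - q ^ Suc (Suc n))"
      using q by (intro mult_left_mono) auto
    thus ?thesis by (simp add: algebra_simps)
  qed
  have "arr_mean q l S (Suc n) (Suc k2) (\<lambda>k. q ^ k) \<le>
      arr_mean q l S n k2 (\<lambda>k. (q * (1 - q ^ Suc n)) * q ^ k) / (1 - q ^ Suc n)"
    unfolding arr_mean_Suc using pos by (intro divide_right_mono arr_mean_mono le) auto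
  thus ?thesis unfolding arr_mean_cmult using pos by simp
qed

lemma arr_mean_power:
  "arr_mean q l S (n + k2) k2 (\<lambda>k. q ^ k) \<le> q ^ k2 * arr_mean q l S n 0 (\<lambda>k. q ^ k)"
proof (induction k2)
  case (Suc k2)
  have "arr_mean q l S (n + Suc k2) (Suc k2) (\<lambda>k. q ^ k) \<le> q * arr_mean q l S (n + k2) k2 (\<lambda>k. q ^ k)"
    using arr_mean_power_Suc[of "n + k2" k2] by simp
  also have "\<dots> \<le> q * (q ^ k2 * arr_mean q l S n 0 (\<lambda>k. q ^ k))"
    using Suc.IH q by (intro mult_left_mono) auto
  finally show ?case by simp
qed simp

lemma arr_mean_0:
  "arr_mean q l S (m + l) 0 g = Lambda q l S * ((\<Sum>k\<le>m. q ^ (l * k) * g k) / qpoch q l m)"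
proof -
  have pos: "0 < qpoch q l m" "0 < mallows_norm q m" "0 < mallows_norm q (m + l)"
    using qpoch_pos[OF q] q mallows_sum_pos by auto
  have "(1 - q) ^ l * mallows_norm q (m + l) = qpoch q l m * mallows_norm q m"
    using mallows_norm_add[of q l m] by (simp add: qpoch_def)
  hence "mallows_norm q m / mallows_norm q (m + l) = (1 - q) ^ l / qpoch q l m"
    using pos by (simp add: field_simps)
  moreover have "arr_mean q l S (m + l) 0 g = (\<Sum>\<sigma>\<in>S. q ^ inversions l \<sigma>) *
      (\<Sum>k\<le>m. q ^ (l * k) * g k) * (mallows_norm q m / mallows_norm q (m + l))"
    by (simp add: arr_mean_def arr_sum_0[OF S])
  ultimately show ?thesis by (simp add: Lambda_eq[OF q S])
qed

lemma sum_power_le: "(\<Sum>k\<le>m. q ^ k) \<le> 1 / (1 - q)"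
proof -
  have "(1 - q) * (\<Sum>k\<le>m. q ^ k) \<le> 1" using q by (simp only: sum_gp_basic) simp
  thus ?thesis using q by (simp add: field_simps)
qed

text \<open>The series is at most \<open>1 / (1 - q)\<close>. The denominator \<open>qpoch q l m\<close> is within \<open>l * q ^ m\<close> of \<open>1\<close> and never
smaller than \<open>(1 - q) ^ l\<close>; the second term, which accounts for it, is crude but carries \<open>q ^ m\<close>, which
together with the factor \<open>q ^ k2\<close> of \<open>arr_mean_power\<close> becomes \<open>q ^ (n - l)\<close>.\<close>

lemma arr_mean_power_0:
  "arr_mean q l S (m + l) 0 (\<lambda>k. q ^ k) \<le>
    Lambda q l S * (1 / (1 - q) + real l * q ^ m / (1 - q) ^ (l + 1))"
proof -
  define P where "P = qpoch q l m"
  have P: "0 < P" unfolding P_def by (rule qpoch_pos[OF q])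
  have "(1 - q) ^ l = (\<Prod>i=1..l. 1 - q)" by simp
  also have "\<dots> \<le> P"
    unfolding P_def qpoch_def using q by (intro prod_mono conjI one_minus_power_bounds[OF q]) auto
  finally have Pge: "(1 - q) ^ l \<le> P" .
  have "1 - P \<le> real l * q ^ Suc m" unfolding P_def by (rule one_minus_qpoch_le[OF q])
  also have "\<dots> \<le> real l * q ^ m" using q by (intro mult_left_mono power_decreasing) auto
  finally have Ple: "1 - P \<le> real l * q ^ m" .
  have "1 / P = 1 + (1 - P) / P" using P by (simp add: field_simps)
  also have "(1 - P) / P \<le> real l * q ^ m / (1 - q) ^ l"
    using Ple Pge q by (intro frac_le) auto
  finally have invP: "1 / P \<le> 1 + real l * q ^ m / (1 - q) ^ l" by simp
  have "(\<Sum>k\<le>m. q ^ (l * k) * q ^ k) \<le> (\<Sum>k\<le>m. q ^ k)"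
    using q by (intro sum_mono) (auto simp: power_le_one mult_le_cancel_right1)
  also have "\<dots> \<le> 1 / (1 - q)" by (rule sum_power_le)
  finally have T: "(\<Sum>k\<le>m. q ^ (l * k) * q ^ k) \<le> 1 / (1 - q)" .
  have "(\<Sum>k\<le>m. q ^ (l * k) * q ^ k) / P = (\<Sum>k\<le>m. q ^ (l * k) * q ^ k) * (1 / P)" by simp
  also have "\<dots> \<le> 1 / (1 - q) * (1 + real l * q ^ m / (1 - q) ^ l)"
    using T invP P q by (intro mult_mono) (auto intro!: sum_nonneg)
  also have "\<dots> = 1 / (1 - q) + real l * q ^ m / (1 - q) ^ (l + 1)"
    using q by (simp add: distrib_left mult.commute)
  finally show ?thesis
    unfolding arr_mean_0 P_def[symmetric] using Lambda_nonneg by (intro mult_left_mono)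
qed

text \<open>Counting with weight \<open>1\<close> is compared with counting with the survival weight \<open>h\<close>. For the latter the exact value
is known up to the truncation of the q-beta sum; the difference is controlled by
\<open>1 - h k \<le> l * q ^ k\<close> and the decay of the weight \<open>q ^ k\<close>.\<close>

lemma arr_mean_1_approx:
  assumes n: "n = m + l + k2"
  shows "\<bar>arr_mean q l S n k2 (\<lambda>_. 1) - Lambda q l S * qbeta q l (l - 1)\<bar> \<le>
    Lambda q l S * (real l)\<^sup>2 * (q ^ m / (1 - q) + q ^ k2 / (1 - q) + q ^ (n - l) / (1 - q) ^ (l + 1))"
proof -
  define h where "h = qpoch q (l - 1)"
  define L where "L = Lambda q l S"
  have L: "0 \<le> L" unfolding L_def by (rule Lambda_nonneg)
  define M where "M = arr_mean q l S n k2"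
  have Mh: "M h = L * ((\<Sum>k\<le>m. q ^ (l * k) * h k) / qpoch q l m)"
    unfolding M_def h_def n arr_mean_qpoch arr_mean_0 L_def ..
  \<comment> \<open>The truncation error, which is small unless the block is near the right end.\<close>
  have A: "\<bar>M h - L * qbeta q l (l - 1)\<bar> \<le> L * ((real l)\<^sup>2 * q ^ m / (1 - q))"
  proof -
    have "\<bar>M h - L * qbeta q l (l - 1)\<bar> =
        L * \<bar>(\<Sum>k\<le>m. q ^ (l * k) * h k) / qpoch q l m - qbeta q l (l - 1)\<bar>"
      unfolding Mh right_diff_distrib[symmetric] abs_mult using L by simp
    also have "\<dots> \<le> L * ((real l)\<^sup>2 * q ^ m / (1 - q))"
      unfolding h_def using L l by (intro mult_left_mono truncated_q_beta[OF q]) auto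
    finally show ?thesis .
  qed
  have d: "0 \<le> 1 - h k" "1 - h k \<le> real l * q ^ k" for k
  proof -
    show "0 \<le> 1 - h k" using qpoch_le_1[OF q] by (simp add: h_def)
    have "1 - h k \<le> real (l - 1) * q ^ Suc k" unfolding h_def by (rule one_minus_qpoch_le[OF q])
    also have "\<dots> \<le> real l * q ^ k" using q by (intro mult_mono power_decreasing) auto
    finally show "1 - h k \<le> real l * q ^ k" .
  qed
  \<comment> \<open>The effect of the weight, which is small unless the block is near the left end.\<close>
  have B0: "0 \<le> M (\<lambda>_. 1) - M h"
  proof -
    have "M (\<lambda>k. 0 * 0) \<le> M (\<lambda>k. 1 - h k)" unfolding M_def using d by (intro arr_mean_mono) auto
    thus ?thesis unfolding M_def arr_mean_diff arr_mean_cmult by simp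
  qed
  have "M (\<lambda>_. 1) - M h = M (\<lambda>k. 1 - h k)" unfolding M_def arr_mean_diff ..
  also have "\<dots> \<le> M (\<lambda>k. real l * q ^ k)" unfolding M_def using d by (intro arr_mean_mono)
  also have "\<dots> = real l * M (\<lambda>k. q ^ k)" unfolding M_def arr_mean_cmult ..
  also have "\<dots> \<le> real l * (q ^ k2 * (L * (1 / (1 - q) + real l * q ^ m / (1 - q) ^ (l + 1))))"
    unfolding M_def n L_def using q
    by (intro mult_left_mono order_trans[OF arr_mean_power] arr_mean_power_0) auto
  also have "\<dots> = L * (real l * (q ^ k2 / (1 - q)) + (real l)\<^sup>2 * (q ^ (n - l) / (1 - q) ^ (l + 1)))"
    by (simp add: n power_add power2_eq_square algebra_simps)
  also have "\<dots> \<le> L * ((real l)\<^sup>2 * (q ^ k2 / (1 - q)) + (real l)\<^sup>2 * (q ^ (n - l) / (1 - q) ^ (l + 1)))"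
    using L q l by (intro mult_left_mono add_mono mult_right_mono) (auto simp: power2_eq_square)
  finally have B: "M (\<lambda>_. 1) - M h \<le> \<dots>" .
  have "\<bar>M (\<lambda>_. 1) - L * qbeta q l (l - 1)\<bar> \<le> L * ((real l)\<^sup>2 * q ^ m / (1 - q)) +
      L * ((real l)\<^sup>2 * (q ^ k2 / (1 - q)) + (real l)\<^sup>2 * (q ^ (n - l) / (1 - q) ^ (l + 1)))"
    using A B B0 by linarith
  also have "\<dots> = L * (real l)\<^sup>2 * (q ^ m / (1 - q) + q ^ k2 / (1 - q) + q ^ (n - l) / (1 - q) ^ (l + 1))"
    by (simp add: algebra_simps)
  finally show ?thesis unfolding M_def L_def .
qed

text \<open>Summing the errors at the individual positions: the terms \<open>q ^ m\<close> and \<open>q ^ k2\<close> each add up to at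
most \<open>1 / (1 - q)\<close>.\<close>

lemma expectation_Arr_approx:
  assumes n: "l \<le> n"
  shows "\<bar>measure_pmf.expectation (mallows n q) (\<lambda>\<pi>. real (Arr l S n \<pi>)) -
      real (n - l + 1) * (Lambda q l S * qbeta q l (l - 1))\<bar> \<le>
    Lambda q l S * (real l)\<^sup>2 * (2 / (1 - q)\<^sup>2 + real n * (q ^ (n - l) / (1 - q) ^ (l + 1)))"
proof -
  define N where "N = n - l"
  define L where "L = Lambda q l S"
  define R where "R = q ^ N / (1 - q) ^ (l + 1)"
  have L: "0 \<le> L" unfolding L_def by (rule Lambda_nonneg)
  have R: "0 \<le> R" unfolding R_def using q by simp
  have "measure_pmf.expectation (mallows n q) (\<lambda>\<pi>. real (Arr l S n \<pi>)) - real (n - l + 1) * (L * qbeta q l (l - 1))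
      = (\<Sum>k2\<le>N. arr_mean q l S n k2 (\<lambda>_. 1) - L * qbeta q l (l - 1))"
    using expectation_Arr[OF q(1) n, of S] by (simp add: N_def sum_subtractf)
  also have "\<bar>\<dots>\<bar> \<le> (\<Sum>k2\<le>N. \<bar>arr_mean q l S n k2 (\<lambda>_. 1) - L * qbeta q l (l - 1)\<bar>)"
    by (rule sum_abs)
  also have "\<dots> \<le> (\<Sum>k2\<le>N. L * (real l)\<^sup>2 * (q ^ (N - k2) / (1 - q) + q ^ k2 / (1 - q) + R))"
  proof (rule sum_mono)
    fix k2 assume "k2 \<in> {..N}"
    hence "n = (N - k2) + l + k2" using n by (simp add: N_def)
    from arr_mean_1_approx[OF this]
    show "\<bar>arr_mean q l S n k2 (\<lambda>_. 1) - L * qbeta q l (l - 1)\<bar> \<le>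
        L * (real l)\<^sup>2 * (q ^ (N - k2) / (1 - q) + q ^ k2 / (1 - q) + R)"
      by (simp add: L_def R_def N_def)
  qed
  also have "\<dots> = L * (real l)\<^sup>2 * (((\<Sum>k2\<le>N. q ^ (N - k2)) + (\<Sum>k2\<le>N. q ^ k2)) / (1 - q) + real (N + 1) * R)"
    by (simp add: sum.distrib add_divide_distrib flip: sum_distrib_left sum_divide_distrib)
  also have "(\<Sum>k2\<le>N. q ^ (N - k2)) = (\<Sum>k2\<le>N. q ^ k2)"
    using sum.nat_diff_reindex[of "\<lambda>i. q ^ i" "Suc N"] by (simp only: lessThan_Suc_atMost diff_Suc_Suc)
  also have "L * (real l)\<^sup>2 * (((\<Sum>k2\<le>N. q ^ k2) + (\<Sum>k2\<le>N. q ^ k2)) / (1 - q) + real (N + 1) * R) \<le>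
      L * (real l)\<^sup>2 * ((1 / (1 - q) + 1 / (1 - q)) / (1 - q) + real n * R)"
    using q L R l n sum_power_le[of N]
    by (intro mult_left_mono add_mono divide_right_mono mult_right_mono) (auto simp: N_def)
  also have "(1 / (1 - q) + 1 / (1 - q)) / (1 - q) = 2 / (1 - q)\<^sup>2"
    by (simp add: power2_eq_square)
  finally show ?thesis unfolding R_def L_def N_def .
qed

end

section \<open>Asymptotics\<close>

lemma mallows_scale_at_top:
  fixes q :: "nat \<Rightarrow> real"
  assumes "\<And>n. 0 < q n \<and> q n < 1"
    and "filterlim (\<lambda>n. (1 - q n) * real n / ln (real n)) at_top sequentially"
  shows "filterlim (\<lambda>n. (1 - q n) * real n) at_top sequentially"
proof (rule filterlim_at_top_mono[OF assms(2)])
  show "\<forall>\<^sub>F n in sequentially. (1 - q n) * real n / ln (real n) \<le> (1 - q n) * real n"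
    using eventually_ge_at_top[of 3]
  proof eventually_elim
    fix n :: nat assume "3 \<le> n"
    hence "ln 3 \<le> ln (real n)" by simp
    hence "1 \<le> ln (real n)" using ln3_gt_1 by linarith
    moreover have "0 \<le> (1 - q n) * real n" using assms(1)[of n] by simp
    ultimately have "(1 - q n) * real n / ln (real n) \<le> (1 - q n) * real n / 1"
      by (intro divide_left_mono) auto
    thus "(1 - q n) * real n / ln (real n) \<le> (1 - q n) * real n" by simp
  qed
qed

text \<open>Since \<open>q ^ (n - l) \<le> exp (- (1 - q) * n / 2)\<close> for \<open>n \<ge> 2 * l\<close>, and the exponent exceeds
\<open>(l + 1) * ln n\<close> eventually, the numerator is below \<open>1 / n ^ (l + 1)\<close>. Since \<open>1 - q \<ge> 1 / n\<close> eventually,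
the denominator costs at most a factor \<open>n ^ l\<close>.\<close>

lemma power_tail_negligible:
  fixes q :: "nat \<Rightarrow> real" and l :: nat
  assumes q: "\<And>n. 0 < q n \<and> q n < 1"
    and lim: "filterlim (\<lambda>n. (1 - q n) * real n / ln (real n)) at_top sequentially"
  shows "(\<lambda>n. q n ^ (n - l) / (1 - q n) ^ l) \<longlonglongrightarrow> 0"
proof (rule tendsto_sandwich[OF _ _ tendsto_const lim_1_over_n])
  show "\<forall>\<^sub>F n in sequentially. 0 \<le> q n ^ (n - l) / (1 - q n) ^ l"
    using q by (intro always_eventually allI divide_nonneg_nonneg zero_le_power) (auto simp: less_imp_le)
  have "\<forall>\<^sub>F n in sequentially. 2 * real (l + 1) \<le> (1 - q n) * real n / ln (real n)"
    using lim unfolding filterlim_at_top by blast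
  moreover have "\<forall>\<^sub>F n in sequentially. 1 \<le> (1 - q n) * real n"
    using mallows_scale_at_top[OF assms] unfolding filterlim_at_top by blast
  ultimately show "\<forall>\<^sub>F n in sequentially. q n ^ (n - l) / (1 - q n) ^ l \<le> 1 / real n"
    using eventually_ge_at_top[of "2 * l + 2"]
  proof eventually_elim
    fix n assume x: "2 * real (l + 1) \<le> (1 - q n) * real n / ln (real n)"
      and y: "1 \<le> (1 - q n) * real n" and n: "2 * l + 2 \<le> n"
    have n0: "0 < real n" and ln0: "0 < ln (real n)" using n by auto
    have "real (l + 1) * ln (real n) \<le> (1 - q n) * (real n / 2)"
      using x ln0 by (simp add: field_simps)
    also have "\<dots> \<le> (1 - q n) * real (n - l)"
      using q[of n] n by (intro mult_left_mono) (auto simp: of_nat_diff)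
    finally have expo: "real (l + 1) * ln (real n) \<le> real (n - l) * (1 - q n)"
      by (simp only: mult.commute)
    have "q n \<le> exp (- (1 - q n))" using exp_ge_add_one_self[of "- (1 - q n)"] by simp
    hence "q n ^ (n - l) \<le> exp (- (1 - q n)) ^ (n - l)"
      using q[of n] by (intro power_mono) auto
    also have "\<dots> = exp (- (real (n - l) * (1 - q n)))"
      by (subst exp_of_nat_mult[symmetric]) (simp only: mult_minus_right)
    also have "\<dots> \<le> exp (- (real (l + 1) * ln (real n)))" using expo by simp
    also have "\<dots> = 1 / real n ^ (l + 1)"
      unfolding exp_minus exp_of_nat_mult using n0 by (simp add: divide_inverse)
    finally have num: "q n ^ (n - l) \<le> 1 / real n ^ (l + 1)" .
    have "1 / real n \<le> 1 - q n" using y n0 by (simp add: field_simps)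
    hence "(1 / real n) ^ l \<le> (1 - q n) ^ l" by (intro power_mono) auto
    hence "q n ^ (n - l) / (1 - q n) ^ l \<le> (1 / real n ^ (l + 1)) / (1 / real n) ^ l"
      using num n0 by (intro frac_le) auto
    also have "\<dots> = 1 / real n" using n0 by (simp add: power_divide)
    finally show "q n ^ (n - l) / (1 - q n) ^ l \<le> 1 / real n" .
  qed
qed

lemma Lambda_pos:
  assumes "0 < q" "q < 1" "S \<subseteq> perms l" "S \<noteq> {}"
  shows "0 < Lambda q l S"
  unfolding Lambda_eq[OF assms(1-3)] using assms finite_subset[OF assms(3) finite_perms]
  by (intro mult_pos_pos sum_pos) auto

text \<open>Dividing the error bound of \<open>expectation_Arr_approx\<close> by the main term cancels \<open>Lambda\<close>, and the lower
bound for the q-beta value cancels one factor \<open>1 / (1 - q)\<close>. What is left is of order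
\<open>1 / ((1 - q) * n)\<close> and \<open>q ^ (n - l) / (1 - q) ^ l\<close>.\<close>

lemma expectation_Arr_asymp:
  fixes q :: "nat \<Rightarrow> real"
  assumes l: "2 \<le> l" and S: "S \<noteq> {}" "S \<subseteq> perms l"
    and q: "\<And>n. 0 < q n \<and> q n < 1"
    and lim: "filterlim (\<lambda>n. (1 - q n) * real n / ln (real n)) at_top sequentially"
  shows "(\<lambda>n. measure_pmf.expectation (mallows n (q n)) (\<lambda>\<pi>. real (Arr l S n \<pi>)))
    \<sim>[sequentially] (\<lambda>n. Lambda (q n) l S * qbeta (q n) l (l - 1) * real n)"
proof (rule asymp_equivI')
  define E where "E n = measure_pmf.expectation (mallows n (q n)) (\<lambda>\<pi>. real (Arr l S n \<pi>))" for n
  define c where "c = (\<Prod>i=0..l - 1. 1 / real (l + i))"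
  have c: "0 < c" unfolding c_def using l by (intro prod_pos) auto
  define err where "err n = (real l)\<^sup>2 / c * (2 * (1 / ((1 - q n) * real n)) + q n ^ (n - l) / (1 - q n) ^ l)" for n
  have bound: "\<bar>E n / (Lambda (q n) l S * qbeta (q n) l (l - 1) * real n) - real (n - l + 1) / real n\<bar> \<le> err n"
    if n: "l \<le> n" for n
  proof -
    define Q where "Q = qbeta (q n) l (l - 1)"
    define L where "L = Lambda (q n) l S"
    define p where "p = 1 - q n"
    define R where "R = q n ^ (n - l)"
    have q': "0 < q n" "q n < 1" using q[of n] by auto
    have p: "0 < p" using q' by (simp add: p_def)
    have R: "0 \<le> R" using q' by (simp add: R_def)
    have n0: "0 < real n" using n l by simp
    have L: "0 < L" unfolding L_def by (rule Lambda_pos[OF q' S(2,1)])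
    have Q: "c / p \<le> Q" unfolding c_def Q_def p_def using l by (intro qbeta_lower[OF q']) simp
    have Q0: "0 < Q" using Q c p by (meson divide_pos_pos less_le_trans)
    have "\<bar>E n / (L * Q * real n) - real (n - l + 1) / real n\<bar> =
        \<bar>E n - real (n - l + 1) * (L * Q)\<bar> / (L * Q * real n)"
    proof -
      have "E n / (L * Q * real n) - real (n - l + 1) / real n =
          (E n - real (n - l + 1) * (L * Q)) / (L * Q * real n)"
        using L Q0 n0 by (simp add: field_simps)
      thus ?thesis using L Q0 n0 by (simp add: abs_divide abs_mult)
    qed
    also have "\<dots> \<le> L * (real l)\<^sup>2 * (2 / p\<^sup>2 + real n * (R / p ^ (l + 1))) / (L * Q * real n)"
      using expectation_Arr_approx[OF q' l S(2) n] L Q0 n0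
      by (intro divide_right_mono) (auto simp: E_def L_def Q_def p_def R_def)
    also have "\<dots> = (real l)\<^sup>2 * (2 / p\<^sup>2 + real n * (R / p ^ (l + 1))) / real n * (1 / Q)"
      using L by simp
    also have "\<dots> \<le> (real l)\<^sup>2 * (2 / p\<^sup>2 + real n * (R / p ^ (l + 1))) / real n * (1 / (c / p))"
      using Q c p R n0 Q0 by (intro mult_left_mono divide_left_mono) auto
    also have "\<dots> = (real l)\<^sup>2 / c * (2 * (1 / (p * real n)) + R / p ^ l)"
      using c p n0 by (simp add: field_simps power2_eq_square)
    finally show ?thesis unfolding err_def L_def Q_def p_def R_def .
  qed
  have "(\<lambda>n. 1 / ((1 - q n) * real n)) \<longlonglongrightarrow> 0"
    using mallows_scale_at_top[OF q lim] by (intro real_tendsto_divide_at_top[OF tendsto_const])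
  hence "err \<longlonglongrightarrow> (real l)\<^sup>2 / c * (2 * 0 + 0)"
    unfolding err_def[abs_def] by (intro tendsto_intros power_tail_negligible[OF q lim])
  hence err: "err \<longlonglongrightarrow> 0" by simp
  have "(\<lambda>n. E n / (Lambda (q n) l S * qbeta (q n) l (l - 1) * real n) - real (n - l + 1) / real n) \<longlonglongrightarrow> 0"
    by (rule Lim_null_comparison[OF _ err])
      (use bound in \<open>auto intro: eventually_mono[OF eventually_ge_at_top[of l]]\<close>)
  moreover have "(\<lambda>n. real (n - l + 1) / real n) \<longlonglongrightarrow> 1"
  proof -
    have "(\<lambda>n. 1 - real (l - 1) * (1 / real n)) \<longlonglongrightarrow> 1 - real (l - 1) * 0"
      by (intro tendsto_intros lim_1_over_n)
    moreover have "\<forall>\<^sub>F n in sequentially. 1 - real (l - 1) * (1 / real n) = real (n - l + 1) / real n"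
      using eventually_ge_at_top[of l]
    proof eventually_elim
      fix n assume "l \<le> n"
      thus "1 - real (l - 1) * (1 / real n) = real (n - l + 1) / real n"
        using l by (simp add: field_simps of_nat_diff)
    qed
    ultimately show ?thesis by (simp add: tendsto_cong)
  qed
  ultimately show "(\<lambda>n. E n / (Lambda (q n) l S * qbeta (q n) l (l - 1) * real n)) \<longlonglongrightarrow> 1"
    using tendsto_add by fastforce
qed

text \<open>Dividing each factor \<open>1 - q ^ i\<close> by \<open>1 - q\<close> gives the q-integer \<open>1 + q + \<dots> + q ^ (i - 1)\<close>, which is
continuous at \<open>q = 1\<close> with value \<open>i\<close>.\<close>

lemma qbeta_scaled:
  assumes "q \<noteq> 1"
  shows "(1 - q) * qbeta q a r = (\<Prod>i=1..r. \<Sum>t<i. q ^ t) / (\<Prod>i=0..r. \<Sum>t<a + i. q ^ t)"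
  using assms by (simp add: qbeta_def one_diff_power_eq prod.distrib)

lemma tendsto_scaled_qbeta:
  assumes "q \<longlonglongrightarrow> (1 :: real)" "\<And>n. q n \<noteq> 1" "1 \<le> l"
  shows "(\<lambda>n. (1 - q n) * qbeta (q n) l (l - 1)) \<longlonglongrightarrow> (fact (l - 1))\<^sup>2 / fact (2 * l - 1)"
proof -
  have "(\<lambda>n. (1 - q n) * qbeta (q n) l (l - 1)) \<longlonglongrightarrow>
      (\<Prod>i=1..l - 1. \<Sum>t<i. 1 ^ t) / (\<Prod>i=0..l - 1. \<Sum>t<l + i. 1 ^ t)"
    unfolding qbeta_scaled[OF assms(2)] using assms(3) by (intro tendsto_intros assms(1)) auto
  moreover have "(\<Prod>i=1..l - 1. real i) = fact (l - 1)" by (simp add: fact_prod)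
  moreover have "fact (2 * l - 1) = fact (l - 1) * (\<Prod>i=0..l - 1. real (l + i))"
  proof -
    have "pochhammer (1 :: real) (2 * l - 1) =
        pochhammer 1 (l - 1) * pochhammer (1 + real (l - 1)) (2 * l - 1 - (l - 1))"
      by (rule pochhammer_product) auto
    moreover have "1 + real (l - 1) = real l" "2 * l - 1 - (l - 1) = l" "{0..<l} = {0..l - 1}"
      using assms(3) by auto
    moreover have "pochhammer (real l) l = (\<Prod>i\<in>{0..<l}. real (l + i))"
      by (simp add: pochhammer_prod)
    ultimately show ?thesis by (simp only: pochhammer_fact)
  qed
  ultimately show ?thesis by (simp add: power2_eq_square)
qed

theorem theorem2p1:
  fixes l :: nat and S :: "(nat \<Rightarrow> nat) set" and q :: "nat \<Rightarrow> real"
  assumes "l \<ge> 2"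
    and "S \<noteq> {}" and "S \<subseteq> perms l"
    and "\<And>n. 0 < q n \<and> q n < 1"
    and "\<exists>c>0. \<forall>n. q n \<ge> c"
    and "filterlim (\<lambda>n. (1 - q n) * real n / ln (real n)) at_top sequentially"
  shows "((\<lambda>n. measure_pmf.expectation (mallows n (q n)) (\<lambda>\<pi>. real (Arr l S n \<pi>)))
      \<sim>[sequentially]
    (\<lambda>n. Lambda (q n) l S / (1 - q n ^ l)
      * ((\<Prod>i=1..l - 1. 1 - q n ^ i) / (\<Prod>i=1..l - 1. 1 - q n ^ (l + i))) * real n)) \<and>
    ((\<lambda>n. 1 - q n) \<in> o[sequentially](\<lambda>n. 1) \<longrightarrow>
    (\<lambda>n. measure_pmf.expectation (mallows n (q n)) (\<lambda>\<pi>. real (Arr l S n \<pi>)))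
      \<sim>[sequentially]
    (\<lambda>n. real (card S) * ((fact (l - 1))\<^sup>2 / fact (2 * l - 1)) * real n * (1 - q n) ^ (l - 1)))"
proof (intro conjI impI)
  note first = expectation_Arr_asymp[OF assms(1,2,3,4,6)]
  have "Lambda (q n) l S * qbeta (q n) l (l - 1) * real n = Lambda (q n) l S / (1 - q n ^ l)
      * ((\<Prod>i=1..l - 1. 1 - q n ^ i) / (\<Prod>i=1..l - 1. 1 - q n ^ (l + i))) * real n" for n
  proof -
    have "(\<Prod>i=0..l - 1. 1 - q n ^ (l + i)) = (1 - q n ^ l) * (\<Prod>i=1..l - 1. 1 - q n ^ (l + i))"
      using prod.atLeast_Suc_atMost[of 0 "l - 1" "\<lambda>i. 1 - q n ^ (l + i)"] by simp
    thus ?thesis by (simp add: qbeta_def)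
  qed
  with first show "(\<lambda>n. measure_pmf.expectation (mallows n (q n)) (\<lambda>\<pi>. real (Arr l S n \<pi>)))
      \<sim>[sequentially]
    (\<lambda>n. Lambda (q n) l S / (1 - q n ^ l)
      * ((\<Prod>i=1..l - 1. 1 - q n ^ i) / (\<Prod>i=1..l - 1. 1 - q n ^ (l + i))) * real n)"
    by simp
  assume "(\<lambda>n. 1 - q n) \<in> o[sequentially](\<lambda>n. 1)"
  hence "(\<lambda>n. 1 - q n) \<longlonglongrightarrow> 0" by (auto dest: smalloD_tendsto)
  hence q1: "q \<longlonglongrightarrow> 1" using tendsto_diff[OF tendsto_const[of 1]] by fastforce
  define C where "C = real (card S) * ((fact (l - 1))\<^sup>2 / fact (2 * l - 1))"
  have "finite S" using assms(3) finite_perms by (rule finite_subset)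
  hence C: "C \<noteq> 0" using assms(2) by (simp add: C_def)
  \<comment> \<open>The factor \<open>(1 - q) ^ l\<close> of \<open>Lambda\<close> supplies the \<open>1 - q\<close> that tames the q-beta value and leaves \<open>(1 - q) ^ (l - 1)\<close>.\<close>
  have "(\<lambda>n. (\<Sum>\<sigma>\<in>S. q n ^ inversions l \<sigma>) * ((1 - q n) * qbeta (q n) l (l - 1)) / C) \<longlonglongrightarrow>
      (\<Sum>\<sigma>\<in>S. 1 ^ inversions l \<sigma>) * ((fact (l - 1))\<^sup>2 / fact (2 * l - 1)) / C"
    using assms(1) assms(4) C
    by (intro tendsto_intros q1 tendsto_scaled_qbeta) (auto simp: less_le)
  hence "(\<lambda>n. (\<Sum>\<sigma>\<in>S. q n ^ inversions l \<sigma>) * ((1 - q n) * qbeta (q n) l (l - 1)) / C) \<longlonglongrightarrow> 1"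
    using C by (simp add: C_def)
  moreover have "\<forall>\<^sub>F n in sequentially.
      (\<Sum>\<sigma>\<in>S. q n ^ inversions l \<sigma>) * ((1 - q n) * qbeta (q n) l (l - 1)) / C =
      (Lambda (q n) l S * qbeta (q n) l (l - 1) * real n) / (C * real n * (1 - q n) ^ (l - 1))"
    using eventually_gt_at_top[of 0]
  proof eventually_elim
    fix n :: nat assume n: "0 < n"
    have q': "0 < q n" "q n < 1" using assms(4)[of n] by auto
    have "(1 - q n) ^ l = (1 - q n) ^ (l - 1) * (1 - q n)"
      using assms(1) by (metis power_minus_mult zero_less_numeral less_le_trans)
    hence "Lambda (q n) l S = (1 - q n) ^ (l - 1) * (1 - q n) * (\<Sum>\<sigma>\<in>S. q n ^ inversions l \<sigma>)"
      unfolding Lambda_eq[OF q' assms(3)] by simp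
    moreover have "T * (p * Q) / C = (a * p * T * Q * N) / (C * N * a)"
      if "a \<noteq> 0" "N \<noteq> 0" for a p T Q N :: real
      using that C by (simp add: field_simps)
    ultimately show "(\<Sum>\<sigma>\<in>S. q n ^ inversions l \<sigma>) * ((1 - q n) * qbeta (q n) l (l - 1)) / C =
      (Lambda (q n) l S * qbeta (q n) l (l - 1) * real n) / (C * real n * (1 - q n) ^ (l - 1))"
      using q' n by simp
  qed
  ultimately have "(\<lambda>n. (Lambda (q n) l S * qbeta (q n) l (l - 1) * real n) /
      (C * real n * (1 - q n) ^ (l - 1))) \<longlonglongrightarrow> 1"
    by (simp add: tendsto_cong)
  hence "(\<lambda>n. Lambda (q n) l S * qbeta (q n) l (l - 1) * real n) \<sim>[sequentially]
      (\<lambda>n. C * real n * (1 - q n) ^ (l - 1))"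
    by (rule asymp_equivI')
  with first show "(\<lambda>n. measure_pmf.expectation (mallows n (q n)) (\<lambda>\<pi>. real (Arr l S n \<pi>)))
      \<sim>[sequentially]
    (\<lambda>n. real (card S) * ((fact (l - 1))\<^sup>2 / fact (2 * l - 1)) * real n * (1 - q n) ^ (l - 1))"
    unfolding C_def by (rule asymp_equiv_trans)
qed

end
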